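(* Let $X$ be a finite set, $H$ be a Hilbert space and $\phi:\mathcal{S}_X\to\mathcal{B}(H)$ be a linear map. Consider the conditions (i) $\phi$ is a unital completely positive map; (ii) $(\phi(e_{x,a}))_{x,a}$ is a quantum magic square; and (i') $\phi$ is a completely positive map; (ii') $(\phi(e_{x,a}))_{x,a}\in(\mathcal{D}_{XX}\otimes\mathcal{B}(H))^+$. Then (i)$\Leftrightarrow$(ii) and (i')$\Leftrightarrow$(ii'). Moreover, if $(E_{x,a})_{x,a}$ is a quantum magic square acting on a Hilbert space $H$, then there exists a (unique) unital completely positive map $\phi:\mathcal{S}_X\to\mathcal{B}(H)$ such that $\phi(e_{x,a})=E_{x,a}$ for all $x,a\in X$.
   Context: $\mathcal{D}_{XX}=\mathcal{D}_X\otimes\mathcal{D}_X$, where $\mathcal{D}_X\subseteq M_X$ is the algebra of diagonal $X\times X$ matrices, with diagonal matrix units $\epsilon_{x,x}$. A family $(E_{x,a})_{x,a\in X}$ in $\mathcal{B}(H)$ is identified with $\sum_{x,a}\epsilon_{x,x}\otimes\epsilon_{a,a}\otimes E_{x,a}\in\mathcal{D}_{XX}\otimes\mathcal{B}(H)$ (so positivity means that every $E_{x,a}\ge0$). A quantum magic square on $H$ is a family $(E_{x,a})_{x,a\in X}$ in $\mathcal{B}(H)$ with $E_{x,a}\ge 0$ and $\sum_{b\in X}E_{x,b}=\sum_{y\in X}E_{y,a}=I$ for all $x,a\in X$. Definition of $\mathcal{S}_X$: a bi-isometry is a block operator matrix $V=(V_{a,x})_{a,x\in X}$, $V_{a,x}\in\mathcal{B}(H,K)$,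 with $\sum_a V_{a,x}^*V_{a,x'}=\delta_{x,x'}I$ and $\sum_x V_{a,x}^*V_{a',x}=\delta_{a,a'}I$. Let $(v_{a,x})$ be the universal bi-isometry, i.e. the direct sum of representatives of all unitary equivalence classes of bi-isometries on Hilbert spaces of dimension bounded by a fixed sufficiently large infinite cardinal; let $\mathcal{C}_X$ be the unital C*-algebra generated by $e_{x,x',a,a'}:=v_{a,x}^*v_{a',x'}$, $x,x',a,a'\in X$, and $\mathcal{T}_X=\mathrm{span}\{e_{x,x',a,a'}\}\subseteq\mathcal{C}_X$. Set $e_{x,a}:=e_{x,x,a,a}$ and $\mathcal{S}_X=\mathrm{span}\{e_{x,a}:x,a\in X\}$, viewed as an operator subsystem of $\mathcal{T}_X$. *)

theory Defs
  imports "HOL-Analysis.Analysis"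
begin

section \<open>Complex Hilbert spaces\<close>

text \<open>
  The library only provides real inner product spaces.  The complex inner product is linear in
  the first variable; its real part is the inner product of the underlying real space, so
  that norm and topology are the ones of the library.
\<close>

class complex_inner = real_inner +
  fixes scaleC :: "complex \<Rightarrow> 'a \<Rightarrow> 'a"
    and cinner :: "'a \<Rightarrow> 'a \<Rightarrow> complex"
  assumes scaleC_add_right: "scaleC c (x + y) = scaleC c x + scaleC c y"
    and scaleC_add_left: "scaleC (c + d) x = scaleC c x + scaleC d x"
    and scaleC_scaleC: "scaleC c (scaleC d x) = scaleC (c * d) x"
    and scaleC_of_real: "scaleC (complex_of_real r) x = scaleR r x"
    and cinner_commute: "cinner x y = cnj (cinner y x)"
    and cinner_add_left: "cinner (x + y) z = cinner x z + cinner y z"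
    and cinner_scaleC_left: "cinner (scaleC c x) y = c * cinner x y"
    and Re_cinner: "Re (cinner x y) = inner x y"

class chilbert_space = complex_inner + complete_space

lemma cinner_scaleC_right:
  fixes x y :: "'a::complex_inner"
  shows "cinner x (scaleC c y) = cnj c * cinner x y"
  by (metis cinner_commute cinner_scaleC_left complex_cnj_mult)

lemma cinner_self:
  fixes x :: "'a::complex_inner"
  shows "cinner x x = of_real ((norm x)\<^sup>2)"
proof (rule complex_eqI)
  have "cinner x x = cnj (cinner x x)" by (rule cinner_commute)
  then show "Im (cinner x x) = Im (of_real ((norm x)\<^sup>2))"
    by (metis Reals_cnj_iff complex_is_Real_iff Im_complex_of_real)
qed (simp add: Re_cinner power2_norm_eq_inner)

lemma norm_scaleC:
  fixes x :: "'a::complex_inner"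
  shows "norm (scaleC c x) = cmod c * norm x"
proof -
  have "complex_of_real ((norm (scaleC c x))\<^sup>2) = (c * cnj c) * of_real ((norm x)\<^sup>2)"
    unfolding cinner_self[symmetric] by (simp add: cinner_scaleC_left cinner_scaleC_right)
  also have "\<dots> = of_real ((cmod c * norm x)\<^sup>2)"
    by (simp add: complex_norm_square[symmetric] power_mult_distrib)
  finally have "(norm (scaleC c x))\<^sup>2 = (cmod c * norm x)\<^sup>2"
    using of_real_eq_iff by blast
  then show ?thesis by (simp add: power2_eq_iff_nonneg)
qed

lemma cmod_cinner_le:
  fixes x y :: "'a::complex_inner"
  shows "cmod (cinner x y) \<le> norm x * norm y"
proof (cases "cinner x y = 0")
  case False
  define u where "u = cnj (cinner x y) / of_real (cmod (cinner x y))"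
  have "cmod u = 1" using False by (simp add: u_def norm_divide)
  have "u * cinner x y = of_real (cmod (cinner x y))"
    using False by (simp add: u_def field_simps complex_norm_square[symmetric] power2_eq_square)
  then have "cinner (scaleC u x) y = of_real (cmod (cinner x y))"
    by (simp add: cinner_scaleC_left)
  then have "cmod (cinner x y) = inner (scaleC u x) y"
    by (metis Re_cinner Re_complex_of_real)
  also have "\<dots> \<le> norm (scaleC u x) * norm y" by (rule norm_cauchy_schwarz)
  finally show ?thesis using \<open>cmod u = 1\<close> by (simp add: norm_scaleC)
qed simp

instantiation complex :: chilbert_space
begin
definition "scaleC_complex = (\<lambda>c x :: complex. c * x)"
definition "cinner_complex = (\<lambda>x y :: complex. x * cnj y)"
instance
  by standard (auto simp: scaleC_complex_def cinner_complex_def algebra_simps scaleR_conv_of_real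
      inner_complex_def)
end

section \<open>Hilbert direct sums\<close>

text \<open>
  The Hilbert space of square summable families of vectors of \<open>'u\<close> indexed by \<open>'i\<close>.
\<close>

typedef (overloaded) ('i, 'u::complex_inner) hsum =
    "{f :: 'i \<Rightarrow> 'u. (\<lambda>i. (norm (f i))\<^sup>2) summable_on UNIV}"
  morphisms hsum_nth Abs_hsum
  by (rule exI[of _ "\<lambda>_. 0"]) simp

setup_lifting type_definition_hsum

lemma hsum_eqI: "(\<And>i. hsum_nth f i = hsum_nth g i) \<Longrightarrow> f = g"
  by (metis ext hsum_nth_inject)

lemma hsum_summable: "(\<lambda>i. (norm (hsum_nth f i))\<^sup>2) summable_on UNIV"
  using hsum_nth[of f] by simp

lemma norm_add_square_le:
  fixes x y :: "'a::real_inner"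
  shows "(norm (x + y))\<^sup>2 \<le> 2 * (norm x)\<^sup>2 + 2 * (norm y)\<^sup>2"
proof -
  have "(norm (x + y))\<^sup>2 + (norm (x - y))\<^sup>2 = 2 * (norm x)\<^sup>2 + 2 * (norm y)\<^sup>2"
    by (simp add: power2_norm_eq_inner algebra_simps)
  then show ?thesis by (smt (verit) zero_le_power2)
qed

lemma sq_summable_add:
  fixes f g :: "'i \<Rightarrow> 'u::real_inner"
  assumes "(\<lambda>i. (norm (f i))\<^sup>2) summable_on UNIV" "(\<lambda>i. (norm (g i))\<^sup>2) summable_on UNIV"
  shows "(\<lambda>i. (norm (f i + g i))\<^sup>2) summable_on UNIV"
proof (rule summable_on_comparison_test)
  show "(\<lambda>i. 2 * (norm (f i))\<^sup>2 + 2 * (norm (g i))\<^sup>2) summable_on UNIV"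
    by (intro summable_on_add summable_on_cmult_right assms)
qed (auto simp: norm_add_square_le)

lemma cinner_summable:
  "(\<lambda>i. cinner (hsum_nth f i) (hsum_nth g i)) summable_on UNIV"
proof (rule abs_summable_summable, rule summable_on_comparison_test)
  show "(\<lambda>i. (norm (hsum_nth f i))\<^sup>2 + (norm (hsum_nth g i))\<^sup>2) summable_on UNIV"
    by (intro summable_on_add hsum_summable)
  fix i
  have "2 * (norm (hsum_nth f i) * norm (hsum_nth g i))
      \<le> (norm (hsum_nth f i))\<^sup>2 + (norm (hsum_nth g i))\<^sup>2"
    using sum_squares_bound[of "norm (hsum_nth f i)" "norm (hsum_nth g i)"] by simp
  moreover have "0 \<le> norm (hsum_nth f i) * norm (hsum_nth g i)" by simp
  ultimately show "norm (cinner (hsum_nth f i) (hsum_nth g i))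
      \<le> (norm (hsum_nth f i))\<^sup>2 + (norm (hsum_nth g i))\<^sup>2"
    using cmod_cinner_le[of "hsum_nth f i" "hsum_nth g i"] by linarith
qed auto

lemma inner_summable:
  "(\<lambda>i. inner (hsum_nth f i) (hsum_nth g i)) summable_on UNIV"
  using summable_on_Re[OF cinner_summable] by (simp add: Re_cinner)

instantiation hsum :: (type, complex_inner) complex_inner
begin

lift_definition zero_hsum :: "('a, 'b) hsum" is "\<lambda>_. 0" by simp

lift_definition plus_hsum :: "('a, 'b) hsum \<Rightarrow> ('a, 'b) hsum \<Rightarrow> ('a, 'b) hsum"
  is "\<lambda>f g i. f i + g i" by (rule sq_summable_add)

lift_definition uminus_hsum :: "('a, 'b) hsum \<Rightarrow> ('a, 'b) hsum" is "\<lambda>f i. - f i" by simp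

lift_definition minus_hsum :: "('a, 'b) hsum \<Rightarrow> ('a, 'b) hsum \<Rightarrow> ('a, 'b) hsum"
  is "\<lambda>f g i. f i - g i"
  using sq_summable_add[where g = "\<lambda>i. - g i" for g] by fastforce

lift_definition scaleR_hsum :: "real \<Rightarrow> ('a, 'b) hsum \<Rightarrow> ('a, 'b) hsum"
  is "\<lambda>r f i. scaleR r (f i)"
  by (auto simp: power_mult_distrib intro: summable_on_cmult_right)

lift_definition scaleC_hsum :: "complex \<Rightarrow> ('a, 'b) hsum \<Rightarrow> ('a, 'b) hsum"
  is "\<lambda>c f i. scaleC c (f i)"
  by (auto simp: norm_scaleC power_mult_distrib intro: summable_on_cmult_right)

definition cinner_hsum :: "('a, 'b) hsum \<Rightarrow> ('a, 'b) hsum \<Rightarrow> complex" where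
  "cinner_hsum f g = (\<Sum>\<^sub>\<infinity>i. cinner (hsum_nth f i) (hsum_nth g i))"

definition inner_hsum :: "('a, 'b) hsum \<Rightarrow> ('a, 'b) hsum \<Rightarrow> real" where
  "inner_hsum f g = (\<Sum>\<^sub>\<infinity>i. inner (hsum_nth f i) (hsum_nth g i))"

definition norm_hsum :: "('a, 'b) hsum \<Rightarrow> real" where
  "norm_hsum f = sqrt (inner f f)"

definition sgn_hsum :: "('a, 'b) hsum \<Rightarrow> ('a, 'b) hsum" where
  "sgn_hsum f = scaleR (inverse (norm f)) f"

definition dist_hsum :: "('a, 'b) hsum \<Rightarrow> ('a, 'b) hsum \<Rightarrow> real" where
  "dist_hsum f g = norm (f - g)"

definition uniformity_hsum :: "(('a, 'b) hsum \<times> ('a, 'b) hsum) filter" where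
  "uniformity_hsum = (INF e\<in>{0<..}. principal {(x, y). dist x y < e})"

definition open_hsum :: "('a, 'b) hsum set \<Rightarrow> bool" where
  "open_hsum U = (\<forall>x\<in>U. \<forall>\<^sub>F (x', y) in uniformity. x' = x \<longrightarrow> y \<in> U)"

instance
proof
  fix f g h :: "('a, 'b) hsum" and r s :: real and c d :: complex
  show "f + g + h = f + (g + h)" by transfer (simp add: algebra_simps)
  show "f + g = g + f" by transfer (simp add: algebra_simps)
  show "0 + f = f" by transfer simp
  show "- f + f = 0" by transfer simp
  show "f - g = f + - g" by transfer simp
  show "scaleR r (f + g) = scaleR r f + scaleR r g" by transfer (simp add: algebra_simps)
  show "scaleR (r + s) f = scaleR r f + scaleR s f" by transfer (simp add: algebra_simps)
  show "scaleR r (scaleR s f) = scaleR (r * s) f" by transfer simp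
  show "scaleR 1 f = f" by transfer simp
  show "dist f g = norm (f - g)" by (rule dist_hsum_def)
  show "sgn f = scaleR (inverse (norm f)) f" by (rule sgn_hsum_def)
  show "uniformity = (INF e\<in>{0<..}. principal {(x :: ('a, 'b) hsum, y). dist x y < e})"
    by (rule uniformity_hsum_def)
  show "open U = (\<forall>x\<in>U. \<forall>\<^sub>F (x', y) in uniformity. x' = x \<longrightarrow> y \<in> U)"
    for U :: "('a, 'b) hsum set" by (rule open_hsum_def)
  show "inner f g = inner g f" by (simp add: inner_hsum_def inner_commute)
  show "inner (f + g) h = inner f h + inner g h"
    by (simp add: inner_hsum_def plus_hsum.rep_eq inner_add_left infsum_add inner_summable)
  show "inner (scaleR r f) g = r * inner f g"
    by (simp add: inner_hsum_def scaleR_hsum.rep_eq infsum_cmult_right')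
  show "0 \<le> inner f f" by (simp add: inner_hsum_def infsum_nonneg)
  show "inner f f = 0 \<longleftrightarrow> f = 0"
  proof
    assume "inner f f = 0"
    then have "inner (hsum_nth f i) (hsum_nth f i) = 0" for i
      using nonneg_infsum_le_0D[of "\<lambda>i. inner (hsum_nth f i) (hsum_nth f i)" UNIV i]
        inner_summable[of f f] by (simp add: inner_hsum_def)
    then show "f = 0" by (intro hsum_eqI) (simp add: zero_hsum.rep_eq)
  qed (simp add: inner_hsum_def zero_hsum.rep_eq)
  show "norm f = sqrt (inner f f)" by (rule norm_hsum_def)
  show "scaleC c (f + g) = scaleC c f + scaleC c g" by transfer (simp add: scaleC_add_right)
  show "scaleC (c + d) f = scaleC c f + scaleC d f" by transfer (simp add: scaleC_add_left)
  show "scaleC c (scaleC d f) = scaleC (c * d) f" by transfer (simp add: scaleC_scaleC)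
  show "scaleC (complex_of_real r) f = scaleR r f" by transfer (simp add: scaleC_of_real)
  show "cinner f g = cnj (cinner g f)"
    unfolding cinner_hsum_def infsum_cnj[symmetric] cinner_commute[symmetric] ..
  show "cinner (f + g) h = cinner f h + cinner g h"
    by (simp add: cinner_hsum_def plus_hsum.rep_eq cinner_add_left infsum_add cinner_summable)
  show "cinner (scaleC c f) g = c * cinner f g"
    by (simp add: cinner_hsum_def scaleC_hsum.rep_eq cinner_scaleC_left infsum_cmult_right')
  show "Re (cinner f g) = inner f g"
    by (simp add: cinner_hsum_def inner_hsum_def infsum_Re[OF cinner_summable, symmetric] Re_cinner)
qed

end

lemma norm_hsum_sq: "(norm (f :: ('i, 'u::complex_inner) hsum))\<^sup>2 = (\<Sum>\<^sub>\<infinity>i. (norm (hsum_nth f i))\<^sup>2)"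
  by (simp add: power2_norm_eq_inner inner_hsum_def)

lemma sum_norm_hsum_le:
  fixes f :: "('i, 'u::complex_inner) hsum"
  assumes "finite F"
  shows "(\<Sum>i\<in>F. (norm (hsum_nth f i))\<^sup>2) \<le> (norm f)\<^sup>2"
  unfolding norm_hsum_sq by (rule finite_sum_le_infsum) (auto simp: assms hsum_summable)

lemma norm_hsum_nth_le: "norm (hsum_nth f i) \<le> norm f"
  using sum_norm_hsum_le[of "{i}" f] by (simp add: power2_le_iff_abs_le)

instance hsum :: (type, chilbert_space) chilbert_space
proof
  fix X :: "nat \<Rightarrow> ('a, 'b) hsum"
  assume X: "Cauchy X"
  have "Cauchy (\<lambda>n. hsum_nth (X n) i)" for i
  proof (rule metric_CauchyI)
    fix e :: real assume "e > 0"
    then obtain M where M: "\<And>m n. m \<ge> M \<Longrightarrow> n \<ge> M \<Longrightarrow> dist (X m) (X n) < e"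
      using metric_CauchyD[OF X] by blast
    have "dist (hsum_nth (X m) i) (hsum_nth (X n) i) \<le> dist (X m) (X n)" for m n
      using norm_hsum_nth_le[of "X m - X n" i] by (simp add: dist_norm minus_hsum.rep_eq)
    with M show "\<exists>M. \<forall>m\<ge>M. \<forall>n\<ge>M. dist (hsum_nth (X m) i) (hsum_nth (X n) i) < e"
      by (meson le_less_trans)
  qed
  then have "\<exists>l. (\<lambda>n. hsum_nth (X n) i) \<longlonglongrightarrow> l" for i
    using Cauchy_convergent convergent_def by blast
  then obtain l where l: "\<And>i. (\<lambda>n. hsum_nth (X n) i) \<longlonglongrightarrow> l i" by metis
  have bound: "(\<Sum>i\<in>F. (norm (hsum_nth (X n) i - l i))\<^sup>2) \<le> e\<^sup>2"
    if "finite F" "\<And>m. m \<ge> n \<Longrightarrow> dist (X n) (X m) < e" for F n e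
  proof (rule LIMSEQ_le_const2)
    show "(\<lambda>m. \<Sum>i\<in>F. (norm (hsum_nth (X n) i - hsum_nth (X m) i))\<^sup>2)
        \<longlonglongrightarrow> (\<Sum>i\<in>F. (norm (hsum_nth (X n) i - l i))\<^sup>2)"
      by (intro tendsto_intros l)
    have "(\<Sum>i\<in>F. (norm (hsum_nth (X n) i - hsum_nth (X m) i))\<^sup>2) \<le> e\<^sup>2" if "m \<ge> n" for m
    proof -
      have "(\<Sum>i\<in>F. (norm (hsum_nth (X n - X m) i))\<^sup>2) \<le> (norm (X n - X m))\<^sup>2"
        by (rule sum_norm_hsum_le) fact
      also have "\<dots> \<le> e\<^sup>2"
        using \<open>\<And>m. m \<ge> n \<Longrightarrow> dist (X n) (X m) < e\<close>[OF that]
        by (intro power_mono) (auto simp: dist_norm)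
      finally show ?thesis by (simp add: minus_hsum.rep_eq)
    qed
    then show "\<exists>N. \<forall>m\<ge>N. (\<Sum>i\<in>F. (norm (hsum_nth (X n) i - hsum_nth (X m) i))\<^sup>2) \<le> e\<^sup>2"
      by blast
  qed
  have summ: "(\<lambda>i. (norm (hsum_nth (X n) i - l i))\<^sup>2) summable_on UNIV"
    if "\<And>m. m \<ge> n \<Longrightarrow> dist (X n) (X m) < e" for n e
    by (rule nonneg_bdd_above_summable_on) (auto intro!: bdd_aboveI[of _ "e\<^sup>2"] bound that)
  obtain M where "\<And>m n. m \<ge> M \<Longrightarrow> n \<ge> M \<Longrightarrow> dist (X m) (X n) < 1"
    using metric_CauchyD[OF X zero_less_one] by blast
  then have "(\<lambda>i. (norm (hsum_nth (X M) i - l i))\<^sup>2) summable_on UNIV"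
    using summ[of M 1] by simp
  then have "(\<lambda>i. (norm (hsum_nth (X M) i + - (hsum_nth (X M) i - l i)))\<^sup>2) summable_on UNIV"
    by (intro sq_summable_add hsum_summable) (simp only: norm_minus_cancel)
  then have "(\<lambda>i. (norm (l i))\<^sup>2) summable_on UNIV" by simp
  then have L: "hsum_nth (Abs_hsum l) = l" by (simp add: Abs_hsum_inverse)
  have "X \<longlonglongrightarrow> Abs_hsum l"
  proof (rule metric_LIMSEQ_I)
    fix e :: real assume "e > 0"
    then obtain M where M: "\<And>m n. m \<ge> M \<Longrightarrow> n \<ge> M \<Longrightarrow> dist (X m) (X n) < e / 2"
      using metric_CauchyD[OF X, of "e / 2"] by auto
    have "dist (X n) (Abs_hsum l) < e" if "n \<ge> M" for n
    proof -
      have d: "dist (X n) (X m) < e / 2" if "m \<ge> n" for m using M that \<open>n \<ge> M\<close> by auto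
      have "(norm (X n - Abs_hsum l))\<^sup>2 \<le> (e / 2)\<^sup>2"
        unfolding norm_hsum_sq minus_hsum.rep_eq L
        by (rule infsum_le_finite_sums[OF summ[OF d]]) (auto intro: bound d)
      then have "norm (X n - Abs_hsum l) \<le> e / 2"
        using \<open>e > 0\<close> by (simp add: power2_le_iff_abs_le)
      with \<open>e > 0\<close> show ?thesis by (simp add: dist_norm)
    qed
    then show "\<exists>M. \<forall>n\<ge>M. dist (X n) (Abs_hsum l) < e" by blast
  qed
  then show "convergent X" by (auto simp: convergent_def)
qed

text \<open>
  Every Hilbert space of dimension at most \<open>|'k|\<close> is unitarily equivalent to a closed subspace
  of \<open>'k ell2\<close>.
\<close>

type_synonym 'k ell2 = "('k, complex) hsum"

section \<open>Operators between closed subspaces\<close>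

definition closed_csubspace :: "'a::chilbert_space set \<Rightarrow> bool" where
  "closed_csubspace H \<longleftrightarrow> closed H \<and> 0 \<in> H \<and> (\<forall>x\<in>H. \<forall>y\<in>H. x + y \<in> H) \<and>
     (\<forall>c. \<forall>x\<in>H. scaleC c x \<in> H)"

text \<open>
  The bounded operators from \<open>H\<close> to \<open>K\<close>.  Being functions on the whole type, they
  are set to \<open>0\<close> outside \<open>H\<close>, so that equality of operators is equality of functions.
  For \<open>H = UNIV\<close> the convention is void.
\<close>

definition bop :: "'a::chilbert_space set \<Rightarrow> 'b::chilbert_space set \<Rightarrow> ('a \<Rightarrow> 'b) set" where
  "bop H K = {T. (\<forall>x. x \<notin> H \<longrightarrow> T x = 0) \<and> (\<forall>x\<in>H. T x \<in> K) \<and>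
     (\<forall>x\<in>H. \<forall>y\<in>H. T (x + y) = T x + T y) \<and>
     (\<forall>c. \<forall>x\<in>H. T (scaleC c x) = scaleC c (T x)) \<and>
     (\<exists>M. \<forall>x\<in>H. norm (T x) \<le> M * norm x)}"

definition id_op :: "'a::chilbert_space set \<Rightarrow> 'a \<Rightarrow> 'a" where
  "id_op H = (\<lambda>x. if x \<in> H then x else 0)"

definition adj :: "'a::chilbert_space set \<Rightarrow> 'b::chilbert_space set \<Rightarrow> ('a \<Rightarrow> 'b) \<Rightarrow> ('b \<Rightarrow> 'a)" where
  "adj H K T = (THE S. S \<in> bop K H \<and> (\<forall>x\<in>H. \<forall>y\<in>K. cinner (T x) y = cinner x (S y)))"

definition add_op :: "('a \<Rightarrow> 'b::chilbert_space) \<Rightarrow> ('a \<Rightarrow> 'b) \<Rightarrow> ('a \<Rightarrow> 'b)" where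
  "add_op S T = (\<lambda>x. S x + T x)"

definition scale_op :: "complex \<Rightarrow> ('a \<Rightarrow> 'b::chilbert_space) \<Rightarrow> ('a \<Rightarrow> 'b)" where
  "scale_op c T = (\<lambda>x. scaleC c (T x))"

definition sum_op :: "('i::finite \<Rightarrow> 'a \<Rightarrow> 'b::chilbert_space) \<Rightarrow> ('a \<Rightarrow> 'b)" where
  "sum_op T = (\<lambda>x. \<Sum>i\<in>UNIV. T i x)"

definition span_op :: "('i::finite \<Rightarrow> 'a \<Rightarrow> 'b::chilbert_space) \<Rightarrow> ('a \<Rightarrow> 'b) set" where
  "span_op T = {sum_op (\<lambda>i. scale_op (c i) (T i)) | c. True}"

definition positive_op :: "'a::chilbert_space set \<Rightarrow> ('a \<Rightarrow> 'a) \<Rightarrow> bool" where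
  "positive_op H T \<longleftrightarrow> T \<in> bop H H \<and> (\<forall>x\<in>H. cinner (T x) x \<in> \<real>\<^sub>\<ge>\<^sub>0)"

definition unitary :: "'a::chilbert_space set \<Rightarrow> 'b::chilbert_space set \<Rightarrow> ('a \<Rightarrow> 'b) \<Rightarrow> bool" where
  "unitary H K U \<longleftrightarrow> U \<in> bop H K \<and> U ` H = K \<and> (\<forall>x\<in>H. \<forall>y\<in>H. cinner (U x) (U y) = cinner x y)"

text \<open>
  Norm closed unital *-subalgebras of \<open>bop H H\<close>.  Since operators vanish
  outside \<open>H\<close>, \<open>onorm\<close> is the operator norm.
\<close>

definition cstar_subalgebra :: "'a::chilbert_space set \<Rightarrow> ('a \<Rightarrow> 'a) set \<Rightarrow> bool" where
  "cstar_subalgebra H C \<longleftrightarrow> C \<subseteq> bop H H \<and> id_op H \<in> C \<and>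
     (\<forall>S\<in>C. \<forall>T\<in>C. add_op S T \<in> C) \<and>
     (\<forall>c. \<forall>T\<in>C. scale_op c T \<in> C) \<and>
     (\<forall>S\<in>C. \<forall>T\<in>C. S \<circ> T \<in> C) \<and>
     (\<forall>T\<in>C. adj H H T \<in> C) \<and>
     (\<forall>S T. (\<forall>n::nat. S n \<in> C) \<and> T \<in> bop H H \<and> (\<lambda>n. onorm (\<lambda>x. S n x - T x)) \<longlonglongrightarrow> 0
        \<longrightarrow> T \<in> C)"

definition cstar_generated :: "'a::chilbert_space set \<Rightarrow> ('a \<Rightarrow> 'a) set \<Rightarrow> ('a \<Rightarrow> 'a) set" where
  "cstar_generated H G = \<Inter>{C. cstar_subalgebra H C \<and> G \<subseteq> C}"

text \<open>
  The positive cone of \<open>M\<^sub>n(C)\<close> for a C*-algebra \<open>C\<close> of operators on \<open>H\<close>: matrices over \<open>C\<close>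
  (indices below \<open>n\<close>) that are positive as operators on \<open>H\<^sup>n\<close>.
\<close>

definition mat_pos :: "'a::chilbert_space set \<Rightarrow> ('a \<Rightarrow> 'a) set \<Rightarrow> nat \<Rightarrow> (nat \<Rightarrow> nat \<Rightarrow> 'a \<Rightarrow> 'a) \<Rightarrow> bool" where
  "mat_pos H C n A \<longleftrightarrow> (\<forall>i<n. \<forall>j<n. A i j \<in> C) \<and>
     (\<forall>\<xi>. (\<forall>i<n. \<xi> i \<in> H) \<longrightarrow> (\<Sum>i<n. \<Sum>j<n. cinner (A i j (\<xi> j)) (\<xi> i)) \<in> \<real>\<^sub>\<ge>\<^sub>0)"

section \<open>Bi-isometries\<close>

record ('x, 'u) block_op =
  dom_space :: "'u set"
  cod_space :: "'u set"
  entry :: "'x \<Rightarrow> 'x \<Rightarrow> 'u \<Rightarrow> 'u"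

definition bi_isometry :: "('x::finite, 'u::chilbert_space) block_op \<Rightarrow> bool" where
  "bi_isometry V \<longleftrightarrow>
     closed_csubspace (dom_space V) \<and> closed_csubspace (cod_space V) \<and>
     (\<forall>a x. entry V a x \<in> bop (dom_space V) (cod_space V)) \<and>
     (\<forall>x x'. sum_op (\<lambda>a. adj (dom_space V) (cod_space V) (entry V a x) \<circ> entry V a x')
        = (if x = x' then id_op (dom_space V) else (\<lambda>_. 0))) \<and>
     (\<forall>a a'. sum_op (\<lambda>x. adj (dom_space V) (cod_space V) (entry V a x) \<circ> entry V a' x)
        = (if a = a' then id_op (dom_space V) else (\<lambda>_. 0)))"

definition unitarily_equivalent ::
    "('x, 'u::chilbert_space) block_op \<Rightarrow> ('x, 'u) block_op \<Rightarrow> bool" where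
  "unitarily_equivalent V V' \<longleftrightarrow>
     (\<exists>U W. unitary (dom_space V) (dom_space V') U \<and> unitary (cod_space V) (cod_space V') W \<and>
        (\<forall>a x. entry V' a x \<circ> U = W \<circ> entry V a x))"

text \<open>
  \<open>R\<close> contains exactly one element of every unitary equivalence class of bi-isometries.  With
  \<open>'u = 'k ell2\<close> these are the classes of bi-isometries on Hilbert spaces of dimension
  at most \<open>|'k|\<close>.
\<close>

definition class_representatives :: "('x::finite, 'u::chilbert_space) block_op set \<Rightarrow> bool" where
  "class_representatives R \<longleftrightarrow> (\<forall>V\<in>R. bi_isometry V) \<and>
     (\<forall>V. bi_isometry V \<longrightarrow> (\<exists>!W. W \<in> R \<and> unitarily_equivalent V W))"

lemma bop_zero: "T \<in> bop H K \<Longrightarrow> closed_csubspace H \<Longrightarrow> T 0 = 0"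
proof -
  assume T: "T \<in> bop H K" and H: "closed_csubspace H"
  have "0 \<in> H" using H by (simp add: closed_csubspace_def)
  then have "T (0 + 0) = T 0 + T 0" using T unfolding bop_def by blast
  then show ?thesis by simp
qed

lemma unitary_norm: "unitary H K U \<Longrightarrow> x \<in> H \<Longrightarrow> norm (U x) = norm x"
  unfolding unitary_def by (metis Re_cinner norm_eq_sqrt_inner)

lemma unitary_inj_on: "unitary H K U \<Longrightarrow> inj_on U H"
proof (rule inj_onI)
  fix x y assume U: "unitary H K U" and xy: "x \<in> H" "y \<in> H" "U x = U y"
  have *: "inner (U u) (U w) = inner u w" if "u \<in> H" "w \<in> H" for u w
    using U that unfolding unitary_def by (metis Re_cinner)
  have "inner (x - y) (x - y) = inner (U x - U y) (U x - U y)"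
    using xy(1,2) by (simp add: inner_diff *)
  then show "x = y" using xy(3) by simp
qed

lemma unitary_id_op: "closed_csubspace H \<Longrightarrow> unitary H H (id_op H)"
  unfolding unitary_def bop_def id_op_def closed_csubspace_def
  by (auto intro!: exI[of _ 1])

lemma unitary_comp:
  assumes "unitary H K U" "unitary K L W" "closed_csubspace K"
  shows "unitary H L (W \<circ> U)"
proof -
  have "W 0 = 0" using assms bop_zero unfolding unitary_def by blast
  moreover have "norm (W (U x)) \<le> 1 * norm x" if "x \<in> H" for x
    using unitary_norm[OF assms(1) that] unitary_norm[OF assms(2), of "U x"] that assms(1)
    unfolding unitary_def by auto
  ultimately have "W \<circ> U \<in> bop H L"
    using assms unfolding unitary_def bop_def by (auto intro!: exI[of _ 1])
  with assms show ?thesis unfolding unitary_def by (auto simp: image_comp[symmetric])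
qed

definition inv_op :: "'a::chilbert_space set \<Rightarrow> 'b::chilbert_space set \<Rightarrow> ('a \<Rightarrow> 'b) \<Rightarrow> ('b \<Rightarrow> 'a)" where
  "inv_op H K U = (\<lambda>y. if y \<in> K then inv_into H U y else 0)"

lemma inv_op_apply: "unitary H K U \<Longrightarrow> x \<in> H \<Longrightarrow> inv_op H K U (U x) = x"
  using unitary_inj_on[of H K U] by (auto simp: inv_op_def unitary_def inv_into_f_f)

lemma unitary_inv_op:
  assumes U: "unitary H K U" and H: "closed_csubspace H"
  shows "unitary K H (inv_op H K U)"
proof -
  note i = inv_op_apply[OF U]
  have K: "K = U ` H" using U by (simp add: unitary_def)
  have Hc: "\<And>x y. x \<in> H \<Longrightarrow> y \<in> H \<Longrightarrow> x + y \<in> H" "\<And>c x. x \<in> H \<Longrightarrow> scaleC c x \<in> H"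
    using H by (auto simp: closed_csubspace_def)
  have Ul: "\<And>x y. x \<in> H \<Longrightarrow> y \<in> H \<Longrightarrow> U x + U y = U (x + y)"
    "\<And>c x. x \<in> H \<Longrightarrow> scaleC c (U x) = U (scaleC c x)"
    using U by (auto simp: unitary_def bop_def)
  have "\<forall>y. y \<notin> K \<longrightarrow> inv_op H K U y = 0" by (simp add: inv_op_def)
  moreover have "\<forall>y\<in>K. inv_op H K U y \<in> H" by (auto simp: K i[unfolded K])
  moreover have "\<forall>x\<in>K. \<forall>y\<in>K. inv_op H K U (x + y) = inv_op H K U x + inv_op H K U y"
    unfolding K by (auto simp: Ul Hc i[unfolded K])
  moreover have "\<forall>c. \<forall>x\<in>K. inv_op H K U (scaleC c x) = scaleC c (inv_op H K U x)"
    unfolding K by (auto simp: Ul Hc i[unfolded K])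
  moreover have "\<forall>x\<in>K. norm (inv_op H K U x) \<le> 1 * norm x"
    unfolding K by (auto simp: i[unfolded K] unitary_norm[OF U])
  ultimately have "inv_op H K U \<in> bop K H" unfolding bop_def by blast
  moreover have "inv_op H K U ` K = H" unfolding K by (force simp: i[unfolded K])
  moreover have "\<forall>x\<in>K. \<forall>y\<in>K. cinner (inv_op H K U x) (inv_op H K U y) = cinner x y"
    unfolding K using U by (auto simp: i[unfolded K] unitary_def)
  ultimately show ?thesis unfolding unitary_def by blast
qed

lemma unitarily_equivalent_refl:
  assumes "bi_isometry V"
  shows "unitarily_equivalent V V"
proof -
  have V: "closed_csubspace (dom_space V)" "closed_csubspace (cod_space V)"
    "\<And>a x. entry V a x \<in> bop (dom_space V) (cod_space V)"
    using assms by (auto simp: bi_isometry_def)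
  have "entry V a x \<circ> id_op (dom_space V) = id_op (cod_space V) \<circ> entry V a x" for a x
    using V(3)[of a x] bop_zero[OF V(3,1), of a x]
    by (auto simp: fun_eq_iff id_op_def bop_def)
  then show ?thesis
    unfolding unitarily_equivalent_def using unitary_id_op V by blast
qed

lemma unitarily_equivalent_sym:
  assumes "bi_isometry V" "bi_isometry V'" "unitarily_equivalent V V'"
  shows "unitarily_equivalent V' V"
proof -
  have V: "closed_csubspace (dom_space V)" "closed_csubspace (cod_space V)"
      "\<And>a x. entry V a x \<in> bop (dom_space V) (cod_space V)"
    and V': "closed_csubspace (dom_space V')" "closed_csubspace (cod_space V')"
      "\<And>a x. entry V' a x \<in> bop (dom_space V') (cod_space V')"
    using assms(1,2) by (auto simp: bi_isometry_def)
  obtain U W where U: "unitary (dom_space V) (dom_space V') U"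
    and W: "unitary (cod_space V) (cod_space V') W"
    and UW: "\<And>a x. entry V' a x \<circ> U = W \<circ> entry V a x"
    using assms(3) unfolding unitarily_equivalent_def by blast
  let ?U = "inv_op (dom_space V) (dom_space V') U"
  let ?W = "inv_op (cod_space V) (cod_space V') W"
  have U': "unitary (dom_space V') (dom_space V) ?U" by (rule unitary_inv_op[OF U V(1)])
  have W': "unitary (cod_space V') (cod_space V) ?W" by (rule unitary_inv_op[OF W V(2)])
  have "entry V a x (?U y) = ?W (entry V' a x y)" for a x y
  proof (cases "y \<in> dom_space V'")
    case True
    then have "y \<in> U ` dom_space V" using U by (simp add: unitary_def)
    then obtain z where z: "z \<in> dom_space V" "y = U z" by blast
    have "entry V' a x y = W (entry V a x z)" using UW[of a x] z by (metis comp_apply)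
    moreover have "entry V a x z \<in> cod_space V" using V(3)[of a x] z by (auto simp: bop_def)
    ultimately show ?thesis using z by (simp add: inv_op_apply[OF U] inv_op_apply[OF W])
  next
    case False
    then have "entry V' a x y = 0" using V'(3)[of a x] by (auto simp: bop_def)
    moreover have "?W 0 = 0" using W' V'(2) bop_zero unfolding unitary_def by blast
    moreover have "?U y = 0" using False by (simp add: inv_op_def)
    ultimately show ?thesis using bop_zero[OF V(3,1), of a x] by simp
  qed
  then have "entry V a x \<circ> ?U = ?W \<circ> entry V' a x" for a x by (simp add: fun_eq_iff)
  with U' W' show ?thesis unfolding unitarily_equivalent_def by blast
qed

lemma unitarily_equivalent_trans:
  assumes "bi_isometry V'" "unitarily_equivalent V V'" "unitarily_equivalent V' V''"
  shows "unitarily_equivalent V V''"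
proof -
  obtain U W where 1: "unitary (dom_space V) (dom_space V') U"
    "unitary (cod_space V) (cod_space V') W" "\<And>a x. entry V' a x \<circ> U = W \<circ> entry V a x"
    using assms(2) unfolding unitarily_equivalent_def by blast
  obtain U' W' where 2: "unitary (dom_space V') (dom_space V'') U'"
    "unitary (cod_space V') (cod_space V'') W'" "\<And>a x. entry V'' a x \<circ> U' = W' \<circ> entry V' a x"
    using assms(3) unfolding unitarily_equivalent_def by blast
  have "entry V'' a x \<circ> (U' \<circ> U) = (W' \<circ> W) \<circ> entry V a x" for a x
    by (metis 1(3) 2(3) comp_assoc)
  moreover have "closed_csubspace (dom_space V')" "closed_csubspace (cod_space V')"
    using assms(1) by (auto simp: bi_isometry_def)
  moreover note unitary_comp[OF 1(1) 2(1)] unitary_comp[OF 1(2) 2(2)]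
  ultimately show ?thesis unfolding unitarily_equivalent_def by blast
qed

lemma class_representatives_exist:
  "\<exists>R :: ('x::finite, 'u::chilbert_space) block_op set. class_representatives R"
proof -
  define rep :: "('x, 'u) block_op \<Rightarrow> ('x, 'u) block_op"
    where "rep V = (SOME W. bi_isometry W \<and> unitarily_equivalent V W)" for V
  have rep: "bi_isometry (rep V)" "unitarily_equivalent V (rep V)" if "bi_isometry V" for V
    using someI[of "\<lambda>W. bi_isometry W \<and> unitarily_equivalent V W" V]
      unitarily_equivalent_refl[OF that] that unfolding rep_def by simp_all
  have rep_eq: "rep V = rep W"
    if "bi_isometry V" "bi_isometry W" "unitarily_equivalent V W" for V W
  proof -
    have "(\<lambda>Z. bi_isometry Z \<and> unitarily_equivalent V Z)
        = (\<lambda>Z. bi_isometry Z \<and> unitarily_equivalent W Z)"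
    proof (rule ext)
      fix Z
      show "(bi_isometry Z \<and> unitarily_equivalent V Z) = (bi_isometry Z \<and> unitarily_equivalent W Z)"
        using unitarily_equivalent_trans[OF that(2,3), of Z]
          unitarily_equivalent_trans[OF that(1) unitarily_equivalent_sym[OF that], of Z] by blast
    qed
    then show ?thesis unfolding rep_def by (rule arg_cong)
  qed
  have "class_representatives (rep ` Collect bi_isometry)"
    unfolding class_representatives_def
  proof (intro conjI ballI allI impI)
    fix V assume "V \<in> rep ` Collect bi_isometry"
    then show "bi_isometry V" using rep by auto
  next
    fix V :: "('x, 'u) block_op" assume V: "bi_isometry V"
    show "\<exists>!W. W \<in> rep ` Collect bi_isometry \<and> unitarily_equivalent V W"
    proof (rule ex1I[of _ "rep V"])
      fix W assume W: "W \<in> rep ` Collect bi_isometry \<and> unitarily_equivalent V W"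
      then obtain Z where Z: "bi_isometry Z" "W = rep Z" by auto
      have "rep V = rep W" using W Z by (intro rep_eq V) (simp_all add: rep)
      moreover have "rep Z = rep W" unfolding Z(2) by (intro rep_eq rep Z(1))
      ultimately show "W = rep V" by (metis Z(2))
    qed (use V rep in simp)
  qed
  then show ?thesis by blast
qed

section \<open>The universal bi-isometry and its operator systems\<close>

definition dsum_space :: "'i set \<Rightarrow> ('i \<Rightarrow> 'u::chilbert_space set) \<Rightarrow> ('i, 'u) hsum set" where
  "dsum_space I H = {f. \<forall>i. if i \<in> I then hsum_nth f i \<in> H i else hsum_nth f i = 0}"

definition dsum_op :: "'i set \<Rightarrow> ('i \<Rightarrow> 'u::chilbert_space set) \<Rightarrow> ('i \<Rightarrow> 'u \<Rightarrow> 'u) \<Rightarrow>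
    ('i, 'u) hsum \<Rightarrow> ('i, 'u) hsum" where
  "dsum_op I H T = (\<lambda>f. if f \<in> dsum_space I H
     then Abs_hsum (\<lambda>i. if i \<in> I then T i (hsum_nth f i) else 0) else 0)"

text \<open>The direct sum is indexed by the representatives themselves.\<close>

type_synonym ('x, 'u) univ_space = "(('x, 'u) block_op, 'u) hsum"

definition univ_dom :: "('x, 'u::chilbert_space) block_op set \<Rightarrow> ('x, 'u) univ_space set" where
  "univ_dom R = dsum_space R dom_space"

definition univ_cod :: "('x, 'u::chilbert_space) block_op set \<Rightarrow> ('x, 'u) univ_space set" where
  "univ_cod R = dsum_space R cod_space"

definition univ_v :: "('x, 'u::chilbert_space) block_op set \<Rightarrow> 'x \<Rightarrow> 'x \<Rightarrow>
    ('x, 'u) univ_space \<Rightarrow> ('x, 'u) univ_space" where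
  "univ_v R a x = dsum_op R dom_space (\<lambda>V. entry V a x)"

definition e4 :: "('x, 'u::chilbert_space) block_op set \<Rightarrow> 'x \<Rightarrow> 'x \<Rightarrow> 'x \<Rightarrow> 'x \<Rightarrow>
    ('x, 'u) univ_space \<Rightarrow> ('x, 'u) univ_space" where
  "e4 R x x' a a' = adj (univ_dom R) (univ_cod R) (univ_v R a x) \<circ> univ_v R a' x'"

abbreviation e2 :: "('x, 'u::chilbert_space) block_op set \<Rightarrow> 'x \<Rightarrow> 'x \<Rightarrow>
    ('x, 'u) univ_space \<Rightarrow> ('x, 'u) univ_space" where
  "e2 R x a \<equiv> e4 R x x a a"

definition C_X :: "('x, 'u::chilbert_space) block_op set \<Rightarrow>
    (('x, 'u) univ_space \<Rightarrow> ('x, 'u) univ_space) set" where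
  "C_X R = cstar_generated (univ_dom R) {e4 R x x' a a' | x x' a a'. True}"

definition T_X :: "('x::finite, 'u::chilbert_space) block_op set \<Rightarrow>
    (('x, 'u) univ_space \<Rightarrow> ('x, 'u) univ_space) set" where
  "T_X R = span_op (\<lambda>(x, x', a, a'). e4 R x x' a a')"

definition S_X :: "('x::finite, 'u::chilbert_space) block_op set \<Rightarrow>
    (('x, 'u) univ_space \<Rightarrow> ('x, 'u) univ_space) set" where
  "S_X R = span_op (\<lambda>(x, a). e2 R x a)"

lemma S_X_subset_T_X: "S_X R \<subseteq> T_X R"
proof
  fix s assume "s \<in> S_X R"
  then obtain c where s: "s = sum_op (\<lambda>p. scale_op (c p) (case p of (x, a) \<Rightarrow> e2 R x a))"
    unfolding S_X_def span_op_def by auto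
  define d where "d = (\<lambda>(x, x', a, a'). if x = x' \<and> a = a' then c (x, a) else 0)"
  define h where "h = (\<lambda>(x :: 'a, a :: 'a). (x, x, a, a))"
  have scaleC_zero: "scaleC 0 (\<eta> :: ('a, 'b) univ_space) = 0" for \<eta>
    using scaleC_of_real[of 0 \<eta>] by simp
  have "s \<xi> = sum_op (\<lambda>q. scale_op (d q) (case q of (x, x', a, a') \<Rightarrow> e4 R x x' a a')) \<xi>" for \<xi>
  proof -
    have "s \<xi> = (\<Sum>q\<in>range h. scaleC (d q) ((case q of (x, x', a, a') \<Rightarrow> e4 R x x' a a') \<xi>))"
      by (subst sum.reindex)
        (auto simp: s sum_op_def scale_op_def h_def d_def inj_on_def intro!: sum.cong)
    also have "\<dots> = (\<Sum>q\<in>UNIV. scaleC (d q) ((case q of (x, x', a, a') \<Rightarrow> e4 R x x' a a') \<xi>))"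
      by (rule sum.mono_neutral_left) (auto simp: d_def h_def scaleC_zero image_iff)
    finally show ?thesis by (simp add: sum_op_def scale_op_def)
  qed
  then show "s \<in> T_X R" unfolding T_X_def span_op_def by blast
qed

section \<open>Maps into the bounded operators on a Hilbert space\<close>

text \<open>
  Maps \<open>\<S>\<^sub>X \<rightarrow> B(H)\<close>, where the type \<open>'h\<close> is the Hilbert space \<open>H\<close>; values
  outside \<open>S_X R\<close> are irrelevant.
\<close>

definition linear_on_S_X :: "('x::finite, 'u::chilbert_space) block_op set \<Rightarrow>
    ((('x, 'u) univ_space \<Rightarrow> ('x, 'u) univ_space) \<Rightarrow> ('h::chilbert_space \<Rightarrow> 'h)) \<Rightarrow> bool" where
  "linear_on_S_X R \<phi> \<longleftrightarrow>
     (\<forall>s\<in>S_X R. \<phi> s \<in> bop UNIV UNIV) \<and>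
     (\<forall>s\<in>S_X R. \<forall>t\<in>S_X R. \<phi> (add_op s t) = add_op (\<phi> s) (\<phi> t)) \<and>
     (\<forall>c. \<forall>s\<in>S_X R. \<phi> (scale_op c s) = scale_op c (\<phi> s))"

definition unital_on_S_X :: "('x::finite, 'u::chilbert_space) block_op set \<Rightarrow>
    ((('x, 'u) univ_space \<Rightarrow> ('x, 'u) univ_space) \<Rightarrow> ('h::chilbert_space \<Rightarrow> 'h)) \<Rightarrow> bool" where
  "unital_on_S_X R \<phi> \<longleftrightarrow> \<phi> (id_op (univ_dom R)) = id_op UNIV"

text \<open>The matrix order of \<open>S_X R\<close> is the one inherited from \<open>T_X R \<subseteq> C_X R\<close>.\<close>

definition cp_on_S_X :: "('x::finite, 'u::chilbert_space) block_op set \<Rightarrow>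
    ((('x, 'u) univ_space \<Rightarrow> ('x, 'u) univ_space) \<Rightarrow> ('h::chilbert_space \<Rightarrow> 'h)) \<Rightarrow> bool" where
  "cp_on_S_X R \<phi> \<longleftrightarrow>
     (\<forall>n A. (\<forall>i<n. \<forall>j<n. A i j \<in> S_X R) \<and> mat_pos (univ_dom R) (C_X R) n A
        \<longrightarrow> mat_pos UNIV (bop UNIV UNIV) n (\<lambda>i j. \<phi> (A i j)))"

text \<open>
  \<open>(E x a)\<close> belongs to \<open>(\<D>\<^sub>X\<^sub>X \<otimes> B(H))\<^sup>+\<close>: with \<open>\<complex>\<^sup>X \<otimes> \<complex>\<^sup>X \<otimes> H\<close> realised as the
  direct sum of copies of \<open>H\<close> indexed by \<open>(x, a)\<close>, the element
  \<open>\<Sum>\<^sub>x\<^sub>,\<^sub>a \<epsilon>\<^sub>x\<^sub>,\<^sub>x \<otimes> \<epsilon>\<^sub>a\<^sub>,\<^sub>a \<otimes> E x a\<close> is the block diagonal operator below.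
\<close>

definition positive_family :: "('x::finite \<Rightarrow> 'x \<Rightarrow> 'h::chilbert_space \<Rightarrow> 'h) \<Rightarrow> bool" where
  "positive_family E \<longleftrightarrow>
     positive_op UNIV (dsum_op (UNIV :: ('x \<times> 'x) set) (\<lambda>_. UNIV) (\<lambda>(x, a). E x a))"

definition quantum_magic_square :: "('x::finite \<Rightarrow> 'x \<Rightarrow> 'h::chilbert_space \<Rightarrow> 'h) \<Rightarrow> bool" where
  "quantum_magic_square E \<longleftrightarrow> (\<forall>x a. positive_op UNIV (E x a)) \<and>
     (\<forall>x. sum_op (\<lambda>b. E x b) = id_op UNIV) \<and> (\<forall>a. sum_op (\<lambda>y. E y a) = id_op UNIV)"

end

theory Submission
  imports Defs
begin

text \<open>
  Since \<open>e\<^sub>x\<^sub>,\<^sub>a = v\<^sub>a\<^sub>,\<^sub>x\<^sup>*v\<^sub>a\<^sub>,\<^sub>x\<close> is positive, a completely positive \<open>\<phi>\<close> has positive values on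
  the generators; and since the generators sum to \<open>1\<close> along rows and along columns, the row and
  column sums of \<open>\<phi>(e\<^sub>x\<^sub>,\<^sub>a)\<close> all equal \<open>\<phi>(1)\<close>.  So everything reduces to one claim: a linear map
  with \<open>E\<^sub>x\<^sub>,\<^sub>a = \<phi>(e\<^sub>x\<^sub>,\<^sub>a) \<ge> 0\<close> is completely positive.

  The idea is that the sesquilinear forms of a positive family with constant row and column sums
  \<open>T\<close> are, on finitely many vectors, those of the generators.  Given \<open>\<xi>\<^sub>0, \<dots>, \<xi>\<^sub>n\<^sub>-\<^sub>1\<close> in \<open>H\<close>, there
  are vectors \<open>\<omega>\<^sub>i\<close> in the domain of the universal bi-isometry with
  \<open>\<langle>e\<^sub>x\<^sub>,\<^sub>a \<omega>\<^sub>i, \<omega>\<^sub>j\<rangle> = \<langle>E\<^sub>x\<^sub>,\<^sub>a \<xi>\<^sub>i, \<xi>\<^sub>j\<rangle>\<close> for all \<open>x, a, i, j\<close> (lemma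
  \<open>realise_positive_family\<close>).  Hence for a positive matrix over the span of the generators the
  quadratic form of its image under \<open>\<phi>\<close> at \<open>(\<xi>\<^sub>i)\<close> is the quadratic form of the matrix itself at
  \<open>(\<omega>\<^sub>i)\<close>, and so nonnegative.  The same lemma with two vectors shows that every linear relation
  between the generators holds in every quantum magic square, so that \<open>e\<^sub>x\<^sub>,\<^sub>a \<mapsto> E\<^sub>x\<^sub>,\<^sub>a\<close> extends
  linearly.

  To find the \<open>\<omega>\<^sub>i\<close>, choose vectors \<open>z\<^sub>x\<^sub>,\<^sub>a\<^sub>,\<^sub>i\<close> with inner products \<open>\<langle>E\<^sub>x\<^sub>,\<^sub>a \<xi>\<^sub>i, \<xi>\<^sub>j\<rangle>\<close> for equal and \<open>0\<close>
  for different \<open>(x, a)\<close>.  These data are finite, so they fit into \<open>\<ell>\<^sup>2\<close> over any infinite index set,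
  whatever the size of \<open>H\<close> (\<open>gram_vectors\<close>).  Let \<open>w\<^sub>i\<close> have inner products \<open>\<langle>T \<xi>\<^sub>i, \<xi>\<^sub>j\<rangle>\<close>; thus the
  form of \<open>T\<close> becomes the inner product, which amounts to the normalisation \<open>T = 1\<close>.  Then
  \<open>V\<^sub>a\<^sub>,\<^sub>x w\<^sub>i = z\<^sub>x\<^sub>,\<^sub>a\<^sub>,\<^sub>i\<close> defines a bi-isometry on the span of the \<open>w\<^sub>i\<close>: the off-diagonal relations hold
  because different blocks have orthogonal ranges, and the diagonal ones because the sums of the
  \<open>E\<^sub>x\<^sub>,\<^sub>a\<close> along any row or column are \<open>T\<close> (\<open>bi_isometry_from_gram\<close>).  It is equivalent to a summand
  of the universal one, where the \<open>w\<^sub>i\<close> become the \<open>\<omega>\<^sub>i\<close>.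
\<close>

section \<open>Elementary calculus in complex Hilbert spaces\<close>

lemma scaleC_zero_left [simp]: "scaleC 0 x = 0"
  using scaleC_of_real[of 0 x] by simp

lemma scaleC_one [simp]: "scaleC 1 x = x"
  using scaleC_of_real[of 1 x] by simp

lemma scaleC_zero_right [simp]: "scaleC c 0 = 0"
  using scaleC_add_right[of c 0 0] by simp

lemma scaleC_minus_left: "scaleC (- c) x = - scaleC c x"
  using scaleC_add_left[of c "- c" x] by (simp add: eq_neg_iff_add_eq_0 add.commute)

lemma scaleC_diff_left: "scaleC (c - d) x = scaleC c x - scaleC d x"
  using scaleC_add_left[of c "- d" x] by (simp add: scaleC_minus_left)

lemma scaleC_sum_right: "scaleC c (\<Sum>i\<in>I. f i) = (\<Sum>i\<in>I. scaleC c (f i))"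
  by (induction I rule: infinite_finite_induct) (auto simp: scaleC_add_right)

lemma cinner_zero_left [simp]: "cinner 0 x = 0"
  using cinner_add_left[of 0 0 x] by simp

lemma cinner_zero_right [simp]: "cinner x 0 = 0"
  by (metis cinner_commute cinner_zero_left complex_cnj_zero)

lemma cinner_add_right: "cinner x (y + z) = cinner x y + cinner x z"
  by (metis cinner_add_left cinner_commute complex_cnj_add)

lemma cinner_minus_left: "cinner (- x) y = - cinner x y"
  using cinner_add_left[of x "- x" y] by (simp add: eq_neg_iff_add_eq_0 add.commute)

lemma cinner_diff_left: "cinner (x - y) z = cinner x z - cinner y z"
  using cinner_add_left[of x "- y" z] by (simp add: cinner_minus_left)

lemma cinner_diff_right: "cinner x (y - z) = cinner x y - cinner x z"
  by (metis cinner_diff_left cinner_commute complex_cnj_diff)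

lemma cinner_sum_left: "cinner (\<Sum>i\<in>I. f i) y = (\<Sum>i\<in>I. cinner (f i) y)"
  by (induction I rule: infinite_finite_induct) (auto simp: cinner_add_left)

lemma cinner_sum_right: "cinner x (\<Sum>i\<in>I. f i) = (\<Sum>i\<in>I. cinner x (f i))"
  by (induction I rule: infinite_finite_induct) (auto simp: cinner_add_right)

lemma cinner_lincomb:
  "cinner (\<Sum>i\<in>I. scaleC (c i) (f i)) (\<Sum>j\<in>J. scaleC (d j) (g j))
    = (\<Sum>i\<in>I. \<Sum>j\<in>J. c i * cnj (d j) * cinner (f i) (g j))"
  unfolding cinner_sum_left cinner_scaleC_left
  unfolding cinner_sum_right cinner_scaleC_right sum_distrib_left mult.assoc ..

lemma cinner_self_eq_0: "cinner x x = 0 \<longleftrightarrow> x = 0"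
  by (simp add: cinner_self)

lemma cinner_self_nonneg: "cinner x x \<in> \<real>\<^sub>\<ge>\<^sub>0"
  unfolding cinner_self by (simp only: nonneg_Reals_of_real_iff zero_le_power2)

lemma nonneg_Reals_sum: "(\<And>i. i \<in> I \<Longrightarrow> f i \<in> \<real>\<^sub>\<ge>\<^sub>0) \<Longrightarrow> (\<Sum>i\<in>I. f i :: complex) \<in> \<real>\<^sub>\<ge>\<^sub>0"
  by (induction I rule: infinite_finite_induct) auto

lemma closed_csubspaceD:
  assumes "closed_csubspace H"
  shows csubspace_zero: "0 \<in> H"
    and csubspace_add: "\<And>x y. x \<in> H \<Longrightarrow> y \<in> H \<Longrightarrow> x + y \<in> H"
    and csubspace_scaleC: "\<And>c x. x \<in> H \<Longrightarrow> scaleC c x \<in> H"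
    and csubspace_scaleR: "\<And>r x. x \<in> H \<Longrightarrow> scaleR r x \<in> H"
  using assms unfolding closed_csubspace_def by (auto simp: scaleC_of_real[symmetric])

lemma csubspace_diff:
  assumes "closed_csubspace H" "x \<in> H" "y \<in> H"
  shows "x - y \<in> H"
  using csubspace_add[OF assms(1,2) csubspace_scaleR[OF assms(1,3), of "- 1"]] by simp

lemma csubspace_sum:
  assumes "closed_csubspace H" "\<And>i. i \<in> I \<Longrightarrow> f i \<in> H"
  shows "(\<Sum>i\<in>I. f i) \<in> H"
  using assms(2)
  by (induction I rule: infinite_finite_induct)
    (auto intro: csubspace_zero csubspace_add assms(1))

lemma closed_csubspace_UNIV: "closed_csubspace UNIV"
  by (simp add: closed_csubspace_def)

lemma csubspace_eqI:
  assumes "closed_csubspace H" "x \<in> H" "y \<in> H" "\<And>z. z \<in> H \<Longrightarrow> cinner x z = cinner y z"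
  shows "x = y"
proof -
  have "cinner (x - y) (x - y) = 0"
    using assms(4)[OF csubspace_diff[OF assms(1-3)]] by (simp only: cinner_diff_left) simp
  then show ?thesis by (simp add: cinner_self_eq_0)
qed

lemma bopD:
  assumes "T \<in> bop H K"
  shows bop_outside: "\<And>x. x \<notin> H \<Longrightarrow> T x = 0"
    and bop_in: "\<And>x. x \<in> H \<Longrightarrow> T x \<in> K"
    and bop_add: "\<And>x y. x \<in> H \<Longrightarrow> y \<in> H \<Longrightarrow> T (x + y) = T x + T y"
    and bop_scaleC: "\<And>c x. x \<in> H \<Longrightarrow> T (scaleC c x) = scaleC c (T x)"
    and bop_bounded: "\<exists>M\<ge>0. \<forall>x\<in>H. norm (T x) \<le> M * norm x"
proof -
  obtain M where M: "\<forall>x\<in>H. norm (T x) \<le> M * norm x" using assms unfolding bop_def by blast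
  have "\<forall>x\<in>H. norm (T x) \<le> \<bar>M\<bar> * norm x"
    using M by (meson abs_ge_self mult_right_mono norm_ge_zero order_trans)
  then show "\<exists>M\<ge>0. \<forall>x\<in>H. norm (T x) \<le> M * norm x" by (intro exI[of _ "\<bar>M\<bar>"]) simp
qed (use assms in \<open>auto simp: bop_def\<close>)

lemma bopI:
  assumes "\<And>x. x \<notin> H \<Longrightarrow> T x = 0" "\<And>x. x \<in> H \<Longrightarrow> T x \<in> K"
    and "\<And>x y. x \<in> H \<Longrightarrow> y \<in> H \<Longrightarrow> T (x + y) = T x + T y"
    and "\<And>c x. x \<in> H \<Longrightarrow> T (scaleC c x) = scaleC c (T x)"
    and "\<And>x. x \<in> H \<Longrightarrow> norm (T x) \<le> M * norm x"
  shows "T \<in> bop H K"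
  using assms unfolding bop_def by blast

lemma bop_lincomb:
  assumes "T \<in> bop H K" "closed_csubspace H" "\<And>i. i \<in> I \<Longrightarrow> f i \<in> H"
  shows "T (\<Sum>i\<in>I. scaleC (c i) (f i)) = (\<Sum>i\<in>I. scaleC (c i) (T (f i)))"
  using assms(3)
proof (induction I rule: infinite_finite_induct)
  case (insert i I)
  have "(\<Sum>i\<in>I. scaleC (c i) (f i)) \<in> H" "scaleC (c i) (f i) \<in> H"
    using insert.prems by (auto intro!: csubspace_sum csubspace_scaleC assms(2))
  then show ?case using insert by (simp add: bop_add[OF assms(1)] bop_scaleC[OF assms(1)])
qed (auto simp: bop_zero[OF assms(1,2)])

section \<open>Riesz representation and adjoints\<close>

text \<open>
  The representing vector is the minimiser of the functional \<open>\<parallel>x\<parallel>\<^sup>2 - 2 Re (f x)\<close> on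
  \<open>H\<close>.  By the parallelogram law a minimising sequence is Cauchy, and the first order condition
  at the minimum says that \<open>Re (f x)\<close> is the real inner product with the minimiser.
\<close>

lemma riesz_representation:
  fixes H :: "'a::chilbert_space set" and f :: "'a \<Rightarrow> complex"
  assumes H: "closed_csubspace H"
    and add: "\<And>x y. x \<in> H \<Longrightarrow> y \<in> H \<Longrightarrow> f (x + y) = f x + f y"
    and scale: "\<And>c x. x \<in> H \<Longrightarrow> f (scaleC c x) = c * f x"
    and bound: "\<And>x. x \<in> H \<Longrightarrow> cmod (f x) \<le> M * norm x"
  shows "\<exists>p\<in>H. \<forall>x\<in>H. f x = cinner x p"
proof -
  define J where "J = (\<lambda>x. (norm x)\<^sup>2 - 2 * Re (f x))"
  define m where "m = Inf (J ` H)"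
  have scaleR: "f (scaleR r x) = of_real r * f x" if "x \<in> H" for r x
    using scale[OF that, of "of_real r"] by (simp add: scaleC_of_real)
  have fdiff: "f (x - y) = f x - f y" if "x \<in> H" "y \<in> H" for x y
    using add[OF that(1) csubspace_scaleR[OF H that(2), of "- 1"]] scaleR[OF that(2), of "- 1"]
    by simp
  have "- M\<^sup>2 \<le> J x" if "x \<in> H" for x
  proof -
    have "Re (f x) \<le> M * norm x"
      using bound[OF that] complex_Re_le_cmod[of "f x"] by linarith
    moreover have "0 \<le> (norm x - M)\<^sup>2" by simp
    ultimately show ?thesis unfolding J_def power2_diff by (simp add: mult.commute)
  qed
  then have bdd: "bdd_below (J ` H)" by (intro bdd_belowI2[of _ "- M\<^sup>2"]) auto
  have ne: "J ` H \<noteq> {}" using csubspace_zero[OF H] by auto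
  have m_le: "m \<le> J x" if "x \<in> H" for x
    unfolding m_def by (rule cInf_lower[OF _ bdd]) (use that in simp)
  have "\<exists>x\<in>H. J x < m + inverse (Suc n)" for n
    using cInf_lessD[OF ne, of "m + inverse (Suc n)"] by (auto simp: m_def)
  then obtain X where X: "\<And>n. X n \<in> H" "\<And>n. J (X n) < m + inverse (Suc n)" by metis
  have par: "(norm (x - y))\<^sup>2 \<le> 2 * (J x - m) + 2 * (J y - m)" if "x \<in> H" "y \<in> H" for x y
  proof -
    define h where "h = scaleR (1/2) (x + y)"
    have h: "h \<in> H" unfolding h_def using csubspace_scaleR[OF H csubspace_add[OF H that]] .
    have "J h = (norm (x + y))\<^sup>2 / 4 - Re (f x) - Re (f y)"
      using that by (simp add: J_def h_def scaleR csubspace_add[OF H] add power_divide add_divide_distrib)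
    moreover have "(norm (x + y))\<^sup>2 + (norm (x - y))\<^sup>2 = 2 * (norm x)\<^sup>2 + 2 * (norm y)\<^sup>2"
      by (simp add: power2_norm_eq_inner algebra_simps)
    ultimately have "(norm (x - y))\<^sup>2 = 2 * J x + 2 * J y - 4 * J h"
      by (simp add: J_def)
    with m_le[OF h] show ?thesis by argo
  qed
  have "Cauchy X"
  proof (rule metric_CauchyI)
    fix e :: real assume e: "e > 0"
    then have "0 < e\<^sup>2 / 4" by simp
    then obtain N where N: "inverse (Suc N) < e\<^sup>2 / 4" using reals_Archimedean by blast
    have "dist (X i) (X j) < e" if "i \<ge> N" "j \<ge> N" for i j
    proof -
      have "inverse (real (Suc i)) \<le> inverse (Suc N)" "inverse (real (Suc j)) \<le> inverse (Suc N)"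
        using that by (auto intro!: le_imp_inverse_le)
      then have "(norm (X i - X j))\<^sup>2 < e\<^sup>2"
        using par[OF X(1) X(1), of i j] X(2)[of i] X(2)[of j] N by argo
      then show ?thesis using e by (simp add: dist_norm power_less_imp_less_base)
    qed
    then show "\<exists>N. \<forall>i\<ge>N. \<forall>j\<ge>N. dist (X i) (X j) < e" by blast
  qed
  then obtain p where p: "X \<longlonglongrightarrow> p" using Cauchy_convergent convergent_def by blast
  have pH: "p \<in> H"
    by (rule closed_sequentially[OF _ X(1) p]) (use H in \<open>simp add: closed_csubspace_def\<close>)
  have "(\<lambda>n. f (X n) - f p) \<longlonglongrightarrow> 0"
  proof (rule tendsto_norm_zero_cancel, rule tendsto_sandwich[of "\<lambda>_. 0"])
    show "\<forall>\<^sub>F n in sequentially. norm (f (X n) - f p) \<le> M * norm (X n - p)"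
      using bound[OF csubspace_diff[OF H X(1) pH]] by (simp add: fdiff[OF X(1) pH])
    show "(\<lambda>n. M * norm (X n - p)) \<longlonglongrightarrow> 0"
      using p by (auto intro!: tendsto_eq_intros simp: LIM_zero_iff)
  qed auto
  then have fX: "(\<lambda>n. f (X n)) \<longlonglongrightarrow> f p" by (simp add: LIM_zero_iff)
  have "(\<lambda>n. J (X n)) \<longlonglongrightarrow> J p" unfolding J_def by (intro tendsto_intros p fX)
  moreover have "(\<lambda>n. m + inverse (real (Suc n))) \<longlonglongrightarrow> m"
    using tendsto_add[OF tendsto_const LIMSEQ_inverse_real_of_nat, of m] by simp
  ultimately have Jp: "J p \<le> m"
    by (rule LIMSEQ_le) (use X(2) in \<open>auto intro: less_imp_le\<close>)
  have re: "Re (f x) = inner p x" if x: "x \<in> H" for x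
  proof (rule ccontr)
    define d where "d = inner p x - Re (f x)"
    assume "Re (f x) \<noteq> inner p x"
    then have d: "d \<noteq> 0" by (simp add: d_def)
    have q: "0 \<le> t\<^sup>2 * (norm x)\<^sup>2 + 2 * t * d" for t
    proof -
      have tx: "scaleR t x \<in> H" by (rule csubspace_scaleR[OF H x])
      have "J (p + scaleR t x) = J p + (t\<^sup>2 * (norm x)\<^sup>2 + 2 * t * d)"
        using x by (simp add: J_def d_def add[OF pH tx] scaleR power2_norm_eq_inner inner_add
            inner_commute algebra_simps power2_eq_square[of t])
      then show ?thesis using m_le[OF csubspace_add[OF H pH tx]] Jp by argo
    qed
    \<comment> \<open>At this \<open>t\<close> the linear term dominates the quadratic one.\<close>
    define t where "t = - d / ((norm x)\<^sup>2 + 1)"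
    have pos: "(norm x)\<^sup>2 + 1 > 0" by (simp add: add_nonneg_pos)
    have d_eq: "d = - (t * ((norm x)\<^sup>2 + 1))" using pos by (simp add: t_def)
    have "t\<^sup>2 * (norm x)\<^sup>2 + 2 * t * d = - (t\<^sup>2 * ((norm x)\<^sup>2 + 2))"
      by (simp only: d_eq) (simp add: algebra_simps power2_eq_square)
    moreover have "t \<noteq> 0" using d pos by (simp add: t_def)
    then have "0 < t\<^sup>2 * ((norm x)\<^sup>2 + 2)" by (simp add: add_nonneg_pos)
    ultimately show False using q[of t] by (metis neg_less_0_iff_less not_le)
  qed
  have "f x = cinner x p" if x: "x \<in> H" for x
  proof (rule complex_eqI)
    show "Re (f x) = Re (cinner x p)" using re[OF x] by (simp add: Re_cinner inner_commute)
    have "- Im (f x) = Re (f (scaleC \<i> x))" by (simp add: scale[OF x])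
    also have "\<dots> = Re (cinner (scaleC \<i> x) p)"
      using re[OF csubspace_scaleC[OF H x]] by (simp add: Re_cinner inner_commute)
    finally show "Im (f x) = Im (cinner x p)" by (simp add: cinner_scaleC_left)
  qed
  with pH show ?thesis by blast
qed

text \<open>
  Adjoints exist between closed subspaces, so that the definite description in the definition
  of \<open>adj\<close> denotes.
\<close>

lemma adj:
  assumes T: "T \<in> bop H K" and H: "closed_csubspace H" and K: "closed_csubspace K"
  shows adj_bop: "adj H K T \<in> bop K H"
    and cinner_adj: "\<And>x y. x \<in> H \<Longrightarrow> y \<in> K \<Longrightarrow> cinner (T x) y = cinner x (adj H K T y)"
proof -
  obtain M where M: "M \<ge> 0" "\<forall>x\<in>H. norm (T x) \<le> M * norm x" using bop_bounded[OF T] by blast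
  have "\<exists>p\<in>H. \<forall>x\<in>H. cinner (T x) y = cinner x p" for y
  proof (rule riesz_representation[OF H])
    fix x assume x: "x \<in> H"
    have "cmod (cinner (T x) y) \<le> norm (T x) * norm y" by (rule cmod_cinner_le)
    also have "\<dots> \<le> (M * norm x) * norm y" using M x by (intro mult_right_mono) auto
    finally show "cmod (cinner (T x) y) \<le> (M * norm y) * norm x" by (simp add: mult_ac)
  qed (simp_all add: bop_add[OF T] bop_scaleC[OF T] cinner_add_left cinner_scaleC_left)
  then obtain P where P: "\<And>y. P y \<in> H" "\<And>x y. x \<in> H \<Longrightarrow> cinner (T x) y = cinner x (P y)"
    by metis
  have eqI: "u = v" if "u \<in> H" "v \<in> H" "\<And>x. x \<in> H \<Longrightarrow> cinner x u = cinner x v" for u v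
    using that by (intro csubspace_eqI[OF H]) (metis cinner_commute)+
  define S where "S = (\<lambda>y. if y \<in> K then P y else 0)"
  have SB: "S \<in> bop K H"
  proof (rule bopI)
    show "S (x + y) = S x + S y" if "x \<in> K" "y \<in> K" for x y
      using that by (intro eqI)
        (auto simp: S_def P(1) csubspace_add[OF K] csubspace_add[OF H] cinner_add_right
          P(2)[symmetric])
    show "S (scaleC c x) = scaleC c (S x)" if "x \<in> K" for c x
      using that by (intro eqI)
        (auto simp: S_def P(1) csubspace_scaleC[OF K] csubspace_scaleC[OF H] cinner_scaleC_right
          P(2)[symmetric])
    show "norm (S y) \<le> M * norm y" if "y \<in> K" for y
    proof (cases "P y = 0")
      case False
      have "(norm (P y))\<^sup>2 = cmod (cinner (P y) (P y))"
        by (simp only: cinner_self norm_of_real abs_power2)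
      also have "\<dots> = cmod (cinner (T (P y)) y)" by (simp add: P)
      also have "\<dots> \<le> norm (T (P y)) * norm y" by (rule cmod_cinner_le)
      also have "\<dots> \<le> (M * norm (P y)) * norm y" using M P by (intro mult_right_mono) auto
      finally have "norm (P y) * norm (P y) \<le> norm (P y) * (M * norm y)"
        by (simp add: power2_eq_square mult_ac)
      then show ?thesis using False that by (simp add: S_def)
    qed (use M that in \<open>simp add: S_def\<close>)
  qed (auto simp: S_def P)
  moreover have SP: "\<forall>x\<in>H. \<forall>y\<in>K. cinner (T x) y = cinner x (S y)" by (simp add: S_def P)
  moreover have "Z = S"
    if Z: "Z \<in> bop K H" "\<forall>x\<in>H. \<forall>y\<in>K. cinner (T x) y = cinner x (Z y)" for Z
  proof
    fix y show "Z y = S y"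
    proof (cases "y \<in> K")
      case True
      with Z SB SP show ?thesis by (intro eqI) (auto simp: bop_in)
    qed (simp add: bop_outside[OF Z(1)] bop_outside[OF SB])
  qed
  ultimately have "adj H K T = S" unfolding adj_def by (intro the_equality) blast+
  with SB SP show "adj H K T \<in> bop K H"
    "\<And>x y. x \<in> H \<Longrightarrow> y \<in> K \<Longrightarrow> cinner (T x) y = cinner x (adj H K T y)" by auto
qed

lemma cinner_adj':
  assumes "T \<in> bop H K" "closed_csubspace H" "closed_csubspace K" "x \<in> H" "y \<in> K"
  shows "cinner (adj H K T y) x = cinner y (T x)"
  using cinner_adj[OF assms] by (metis cinner_commute)

section \<open>Direct sums of operators\<close>

lemma infsum_sum:
  fixes f :: "'i \<Rightarrow> 'j \<Rightarrow> 'a::{topological_comm_monoid_add, t2_space}"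
  assumes "\<And>i. i \<in> I \<Longrightarrow> f i summable_on A"
  shows "(\<Sum>\<^sub>\<infinity>j\<in>A. \<Sum>i\<in>I. f i j) = (\<Sum>i\<in>I. \<Sum>\<^sub>\<infinity>j\<in>A. f i j)"
proof -
  have "(\<lambda>j. \<Sum>i\<in>I. f i j) summable_on A
      \<and> (\<Sum>\<^sub>\<infinity>j\<in>A. \<Sum>i\<in>I. f i j) = (\<Sum>i\<in>I. \<Sum>\<^sub>\<infinity>j\<in>A. f i j)"
    using assms
    by (induction I rule: infinite_finite_induct) (auto simp: infsum_add summable_on_add)
  then show ?thesis by simp
qed

lemma bounded_linear_hsum_nth: "bounded_linear (\<lambda>f. hsum_nth f i)"
  by (rule bounded_linear_intro[where K = 1])
    (auto simp: plus_hsum.rep_eq scaleR_hsum.rep_eq norm_hsum_nth_le)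

lemma closed_csubspace_dsum_space:
  assumes "\<And>i. i \<in> I \<Longrightarrow> closed_csubspace (H i)"
  shows "closed_csubspace (dsum_space I H)"
proof -
  let ?C = "\<lambda>i. if i \<in> I then H i else {0}"
  have "closed_csubspace (?C i)" for i
    using assms by (auto simp: closed_csubspace_def)
  note C = this
  have eq: "dsum_space I H = (\<Inter>i. (\<lambda>f. hsum_nth f i) -` ?C i)"
    by (auto simp: dsum_space_def split: if_splits)
  have "closed (\<Inter>i. (\<lambda>f. hsum_nth f i) -` ?C i)"
  proof (rule closed_INT, rule ballI, rule closed_vimage)
    show "closed (?C i)" for i using C[of i] by (simp only: closed_csubspace_def)
    show "continuous_on UNIV (\<lambda>f. hsum_nth f i)" for i
      using bounded_linear_hsum_nth
      by (rule linear_continuous_on)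
  qed
  then show ?thesis
    unfolding closed_csubspace_def eq[symmetric]
    using csubspace_zero[OF assms] csubspace_add[OF assms] csubspace_scaleC[OF assms]
    by (auto simp: dsum_space_def zero_hsum.rep_eq plus_hsum.rep_eq scaleC_hsum.rep_eq)
qed

text \<open>
  The uniform bound keeps the image family square summable, so that \<open>Abs_hsum\<close> in the
  definition of \<open>dsum_op\<close> is applied to an element of the Hilbert sum.
\<close>

lemma dsum_op:
  fixes H K :: "'i \<Rightarrow> 'u::chilbert_space set"
  assumes H: "\<And>i. i \<in> I \<Longrightarrow> closed_csubspace (H i)"
    and T: "\<And>i. i \<in> I \<Longrightarrow> T i \<in> bop (H i) (K i)"
    and bound: "\<And>i u. i \<in> I \<Longrightarrow> u \<in> H i \<Longrightarrow> norm (T i u) \<le> M * norm u"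
  shows hsum_nth_dsum_op: "\<And>f i. f \<in> dsum_space I H \<Longrightarrow>
      hsum_nth (dsum_op I H T f) i = (if i \<in> I then T i (hsum_nth f i) else 0)"
    and dsum_op_bop: "dsum_op I H T \<in> bop (dsum_space I H) (dsum_space I K)"
proof -
  have le: "(norm (if i \<in> I then T i (hsum_nth f i) else 0))\<^sup>2 \<le> M\<^sup>2 * (norm (hsum_nth f i))\<^sup>2"
    if "f \<in> dsum_space I H" for f i
  proof (cases "i \<in> I")
    case True
    then have "norm (T i (hsum_nth f i)) \<le> M * norm (hsum_nth f i)"
      using that by (intro bound) (auto simp: dsum_space_def)
    then show ?thesis using True power_mono[of _ _ 2] by (fastforce simp: power_mult_distrib)
  qed simp
  have summ: "(\<lambda>i. M\<^sup>2 * (norm (hsum_nth f i))\<^sup>2) summable_on UNIV" for f :: "('i, 'u) hsum"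
    by (intro summable_on_cmult_right hsum_summable)
  show nth: "hsum_nth (dsum_op I H T f) i = (if i \<in> I then T i (hsum_nth f i) else 0)"
    if "f \<in> dsum_space I H" for f i
  proof -
    have "(\<lambda>i. (norm (if i \<in> I then T i (hsum_nth f i) else 0))\<^sup>2) summable_on UNIV"
      using le[OF that] by (intro summable_on_comparison_test[OF summ[of f]]) simp_all
    then have "hsum_nth (Abs_hsum (\<lambda>i. if i \<in> I then T i (hsum_nth f i) else 0))
        = (\<lambda>i. if i \<in> I then T i (hsum_nth f i) else 0)"
      by (intro Abs_hsum_inverse) simp
    then show ?thesis using that by (simp add: dsum_op_def)
  qed
  have D: "closed_csubspace (dsum_space I H)" by (rule closed_csubspace_dsum_space[OF H])
  have in_H: "hsum_nth f i \<in> H i" if "f \<in> dsum_space I H" "i \<in> I" for f i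
    using that by (auto simp: dsum_space_def)
  show "dsum_op I H T \<in> bop (dsum_space I H) (dsum_space I K)"
  proof (rule bopI)
    show "dsum_op I H T f = 0" if "f \<notin> dsum_space I H" for f
      using that by (simp add: dsum_op_def)
    show "dsum_op I H T f \<in> dsum_space I K" if "f \<in> dsum_space I H" for f
      using that bop_in[OF T in_H] by (auto simp: dsum_space_def[of I K] nth)
    show "dsum_op I H T (f + g) = dsum_op I H T f + dsum_op I H T g"
      if "f \<in> dsum_space I H" "g \<in> dsum_space I H" for f g
      using that bop_add[OF T in_H in_H]
      by (intro hsum_eqI) (auto simp: nth plus_hsum.rep_eq csubspace_add[OF D])
    show "dsum_op I H T (scaleC c f) = scaleC c (dsum_op I H T f)"
      if "f \<in> dsum_space I H" for c f
      using that bop_scaleC[OF T in_H]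
      by (intro hsum_eqI) (auto simp: nth scaleC_hsum.rep_eq csubspace_scaleC[OF D])
    show "norm (dsum_op I H T f) \<le> \<bar>M\<bar> * norm f" if f: "f \<in> dsum_space I H" for f
    proof -
      have "(norm (dsum_op I H T f))\<^sup>2 \<le> (\<Sum>\<^sub>\<infinity>i. M\<^sup>2 * (norm (hsum_nth f i))\<^sup>2)"
        unfolding norm_hsum_sq
        by (rule infsum_mono[OF hsum_summable summ]) (simp only: nth[OF f] le[OF f])
      also have "\<dots> = (\<bar>M\<bar> * norm f)\<^sup>2"
        by (simp add: norm_hsum_sq power_mult_distrib infsum_cmult_right')
      finally show ?thesis by (rule power2_le_imp_le) simp
    qed
  qed
qed

definition hsum_single :: "'i \<Rightarrow> 'u::complex_inner \<Rightarrow> ('i, 'u) hsum" where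
  "hsum_single i u = Abs_hsum (\<lambda>j. if j = i then u else 0)"

lemma hsum_nth_single: "hsum_nth (hsum_single i u) j = (if j = i then u else 0)"
proof -
  have "(\<lambda>j. (norm (if j = i then u else 0))\<^sup>2) summable_on UNIV"
    by (rule finite_nonzero_values_imp_summable_on) (rule finite_subset[of _ "{i}"], auto)
  then show ?thesis unfolding hsum_single_def by (subst Abs_hsum_inverse) auto
qed

lemma cinner_hsum_single_right: "cinner f (hsum_single i u) = cinner (hsum_nth f i) u"
proof -
  have "cinner f (hsum_single i u) = (\<Sum>\<^sub>\<infinity>j\<in>{i}. cinner (hsum_nth f j) (hsum_nth (hsum_single i u) j))"
    unfolding cinner_hsum_def by (rule infsum_cong_neutral) (auto simp: hsum_nth_single)
  also have "\<dots> = cinner (hsum_nth f i) u" by (simp add: hsum_nth_single)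
  finally show ?thesis .
qed

text \<open>
  The quadratic form of a block diagonal operator is the sum of those of its blocks, and these are
  its restrictions to the vectors with one nonzero component.
\<close>

lemma positive_family_iff:
  fixes E :: "'x::finite \<Rightarrow> 'x \<Rightarrow> 'h::chilbert_space \<Rightarrow> 'h"
  assumes E: "\<And>x a. E x a \<in> bop UNIV UNIV"
  shows "positive_family E \<longleftrightarrow> (\<forall>x a. positive_op UNIV (E x a))"
proof -
  let ?D = "dsum_op UNIV (\<lambda>_. UNIV) (\<lambda>(x, a). E x a)"
  have "\<exists>M. \<forall>u. norm (E x a u) \<le> M * norm u" for x a using bop_bounded[OF E] by blast
  then obtain M where M: "\<And>x a u. norm (E x a u) \<le> M x a * norm u" by metis
  define N where "N = (\<Sum>(x, a)\<in>UNIV. \<bar>M x a\<bar>)"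
  have MN: "norm (case p of (x, a) \<Rightarrow> E x a u) \<le> N * norm u" for p u
  proof (cases p)
    case (Pair x a)
    have "M x a \<le> N"
      unfolding N_def using member_le_sum[of p UNIV "\<lambda>(x, a). \<bar>M x a\<bar>"] Pair by fastforce
    then have "M x a * norm u \<le> N * norm u" by (intro mult_right_mono) auto
    then show ?thesis using M[of x a u] Pair by simp
  qed
  have all: "f \<in> dsum_space UNIV (\<lambda>_. UNIV)" for f :: "('x \<times> 'x, 'h) hsum"
    by (simp add: dsum_space_def)
  then have UNIV: "dsum_space UNIV (\<lambda>_. UNIV) = (UNIV :: ('x \<times> 'x, 'h) hsum set)" by blast
  have EB: "(case p of (x, a) \<Rightarrow> E x a) \<in> bop UNIV UNIV" for p using E by (cases p) simp
  have bop: "?D \<in> bop UNIV UNIV"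
    using dsum_op_bop[where I = UNIV and H = "\<lambda>_. UNIV" and K = "\<lambda>_. UNIV" and M = N
        and T = "\<lambda>(x, a). E x a"] EB MN by (simp add: UNIV closed_csubspace_UNIV case_prod_unfold)
  have nth: "hsum_nth (?D f) (x, a) = E x a (hsum_nth f (x, a))" for f x a
    using hsum_nth_dsum_op[where I = UNIV and H = "\<lambda>_. UNIV" and K = "\<lambda>_. UNIV" and M = N
        and T = "\<lambda>(x, a). E x a" and f = f and i = "(x, a)"] EB MN
    by (simp add: UNIV closed_csubspace_UNIV case_prod_unfold)
  show ?thesis
  proof
    assume "positive_family E"
    then have "cinner (?D (hsum_single (x, a) u)) (hsum_single (x, a) u) \<in> \<real>\<^sub>\<ge>\<^sub>0" for x a u
      by (simp add: positive_family_def positive_op_def)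
    then show "\<forall>x a. positive_op UNIV (E x a)"
      by (simp add: positive_op_def E cinner_hsum_single_right nth hsum_nth_single)
  next
    assume "\<forall>x a. positive_op UNIV (E x a)"
    then have "cinner (?D f) f \<in> \<real>\<^sub>\<ge>\<^sub>0" for f
      unfolding cinner_hsum_def infsum_finite[OF finite_class.finite_UNIV]
      by (intro nonneg_Reals_sum) (auto simp: nth positive_op_def split: prod.splits)
    with bop show "positive_family E" by (simp add: positive_family_def positive_op_def)
  qed
qed

section \<open>The universal bi-isometry\<close>

text \<open>
  This form of the definition avoids adjoints: the matrix relations of a bi-isometry are relations
  between the inner products of the vectors \<open>V\<^sub>a\<^sub>,\<^sub>x \<xi>\<close>.
\<close>

lemma bi_isometry_iff:
  "bi_isometry V \<longleftrightarrow>
     closed_csubspace (dom_space V) \<and> closed_csubspace (cod_space V) \<and>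
     (\<forall>a x. entry V a x \<in> bop (dom_space V) (cod_space V)) \<and>
     (\<forall>x x'. \<forall>\<xi>\<in>dom_space V. \<forall>\<eta>\<in>dom_space V.
        (\<Sum>a\<in>UNIV. cinner (entry V a x' \<xi>) (entry V a x \<eta>)) = (if x = x' then cinner \<xi> \<eta> else 0)) \<and>
     (\<forall>a a'. \<forall>\<xi>\<in>dom_space V. \<forall>\<eta>\<in>dom_space V.
        (\<Sum>x\<in>UNIV. cinner (entry V a' x \<xi>) (entry V a x \<eta>)) = (if a = a' then cinner \<xi> \<eta> else 0))"
  (is "_ \<longleftrightarrow> ?H \<and> ?K \<and> ?B \<and> _")
proof (cases "?H \<and> ?K \<and> ?B")
  case True
  let ?D = "dom_space V"
  let ?adj = "adj ?D (cod_space V)"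
  have H: ?H and K: ?K and B: "\<And>a x. entry V a x \<in> bop ?D (cod_space V)" using True by auto
  have prod: "sum_op (\<lambda>i. ?adj (entry V (f i) (g i)) \<circ> entry V (f' i) (g' i))
        = (if P then id_op ?D else (\<lambda>_. 0)) \<longleftrightarrow>
      (\<forall>\<xi>\<in>?D. \<forall>\<eta>\<in>?D. (\<Sum>i\<in>UNIV. cinner (entry V (f' i) (g' i) \<xi>) (entry V (f i) (g i) \<eta>))
        = (if P then cinner \<xi> \<eta> else 0))"
    (is "?S = ?I \<longleftrightarrow> ?R") for f g f' g' :: "'a \<Rightarrow> 'a" and P
  proof -
    have S: "cinner (?S \<xi>) \<eta> = (\<Sum>i\<in>UNIV. cinner (entry V (f' i) (g' i) \<xi>) (entry V (f i) (g i) \<eta>))"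
      if "\<xi> \<in> ?D" "\<eta> \<in> ?D" for \<xi> \<eta>
      using that bop_in[OF B] by (simp add: sum_op_def cinner_sum_left cinner_adj'[OF B H K])
    have I: "cinner (?I \<xi>) \<eta> = (if P then cinner \<xi> \<eta> else 0)" if "\<xi> \<in> ?D" for \<xi> \<eta>
      using that by (simp add: id_op_def)
    show ?thesis
    proof
      assume eq: "?S = ?I"
      show ?R
      proof (intro ballI)
        fix \<xi> \<eta> assume \<xi>: "\<xi> \<in> ?D" and \<eta>: "\<eta> \<in> ?D"
        have "cinner (?S \<xi>) \<eta> = cinner (?I \<xi>) \<eta>" by (simp only: eq)
        then show "(\<Sum>i\<in>UNIV. cinner (entry V (f' i) (g' i) \<xi>) (entry V (f i) (g i) \<eta>))
            = (if P then cinner \<xi> \<eta> else 0)"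
          by (simp only: S[OF \<xi> \<eta>] I[OF \<xi>])
      qed
    next
      assume R: ?R
      show "?S = ?I"
      proof
        fix \<xi> show "?S \<xi> = ?I \<xi>"
        proof (cases "\<xi> \<in> ?D")
          case True
          show ?thesis
          proof (rule csubspace_eqI[OF H])
            show "?S \<xi> \<in> ?D"
              unfolding sum_op_def comp_def
              by (intro csubspace_sum[OF H] bop_in[OF adj_bop[OF B H K]] bop_in[OF B True])
            show "?I \<xi> \<in> ?D" using True csubspace_zero[OF H] by (simp add: id_op_def)
            show "cinner (?S \<xi>) \<eta> = cinner (?I \<xi>) \<eta>" if "\<eta> \<in> ?D" for \<eta>
              using R True that by (simp only: S I)
          qed
        next
          case False
          then show ?thesis
            by (simp add: sum_op_def id_op_def bop_outside[OF B False]
                bop_zero[OF adj_bop[OF B H K] K])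
        qed
      qed
    qed
  qed
  have col: "(\<forall>x x'. sum_op (\<lambda>a. ?adj (entry V a x) \<circ> entry V a x')
        = (if x = x' then id_op ?D else (\<lambda>_. 0))) \<longleftrightarrow>
     (\<forall>x x'. \<forall>\<xi>\<in>?D. \<forall>\<eta>\<in>?D.
        (\<Sum>a\<in>UNIV. cinner (entry V a x' \<xi>) (entry V a x \<eta>)) = (if x = x' then cinner \<xi> \<eta> else 0))"
    by (intro arg_cong[where f = All] ext) (rule prod)
  have row: "(\<forall>a a'. sum_op (\<lambda>x. ?adj (entry V a x) \<circ> entry V a' x)
        = (if a = a' then id_op ?D else (\<lambda>_. 0))) \<longleftrightarrow>
     (\<forall>a a'. \<forall>\<xi>\<in>?D. \<forall>\<eta>\<in>?D.
        (\<Sum>x\<in>UNIV. cinner (entry V a' x \<xi>) (entry V a x \<eta>)) = (if a = a' then cinner \<xi> \<eta> else 0))"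
    by (intro arg_cong[where f = All] ext) (rule prod)
  show ?thesis
    unfolding bi_isometry_def by (intro arg_cong2[where f = "(\<and>)"] refl col row)
qed (auto simp: bi_isometry_def)

lemma bi_isometryD:
  assumes "bi_isometry V"
  shows bi_isometry_dom: "closed_csubspace (dom_space V)"
    and bi_isometry_cod: "closed_csubspace (cod_space V)"
    and bi_isometry_entry: "\<And>a x. entry V a x \<in> bop (dom_space V) (cod_space V)"
    and bi_isometry_col: "\<And>x \<xi> \<eta>. \<xi> \<in> dom_space V \<Longrightarrow> \<eta> \<in> dom_space V \<Longrightarrow>
      (\<Sum>a\<in>UNIV. cinner (entry V a x \<xi>) (entry V a x \<eta>)) = cinner \<xi> \<eta>"
    and bi_isometry_row: "\<And>a \<xi> \<eta>. \<xi> \<in> dom_space V \<Longrightarrow> \<eta> \<in> dom_space V \<Longrightarrow>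
      (\<Sum>x\<in>UNIV. cinner (entry V a x \<xi>) (entry V a x \<eta>)) = cinner \<xi> \<eta>"
  using assms unfolding bi_isometry_iff by auto

text \<open>The square norms of the images of a vector under one column of blocks add up to its own.\<close>

lemma bi_isometry_entry_contractive:
  assumes V: "bi_isometry V" and u: "u \<in> dom_space V"
  shows "norm (entry V a x u) \<le> norm u"
proof -
  have "complex_of_real (\<Sum>a\<in>UNIV. (norm (entry V a x u))\<^sup>2) = of_real ((norm u)\<^sup>2)"
    using bi_isometry_col[OF V u u, of x] by (simp add: cinner_self)
  then have "(\<Sum>a\<in>UNIV. (norm (entry V a x u))\<^sup>2) = (norm u)\<^sup>2" by (rule of_real_eq_iff[THEN iffD1])
  moreover have "(norm (entry V a x u))\<^sup>2 \<le> (\<Sum>a\<in>UNIV. (norm (entry V a x u))\<^sup>2)"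
    by (rule member_le_sum) auto
  ultimately have "(norm (entry V a x u))\<^sup>2 \<le> (norm u)\<^sup>2" by simp
  then show ?thesis by (rule power2_le_imp_le) simp
qed

context
  fixes R :: "('x::finite, 'u::chilbert_space) block_op set"
  assumes R: "\<And>V. V \<in> R \<Longrightarrow> bi_isometry V"
begin

lemma closed_univ_dom: "closed_csubspace (univ_dom R)"
  and closed_univ_cod: "closed_csubspace (univ_cod R)"
  unfolding univ_dom_def univ_cod_def
  by (auto intro!: closed_csubspace_dsum_space R bi_isometry_dom bi_isometry_cod)

lemma hsum_nth_univ_v:
  assumes "\<xi> \<in> univ_dom R"
  shows "hsum_nth (univ_v R a x \<xi>) V = (if V \<in> R then entry V a x (hsum_nth \<xi> V) else 0)"
  unfolding univ_v_def
  by (rule hsum_nth_dsum_op[where M = 1 and K = cod_space])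
    (use R assms in \<open>auto intro: bi_isometry_dom bi_isometry_entry bi_isometry_entry_contractive
       simp: univ_dom_def\<close>)

lemma univ_v_bop: "univ_v R a x \<in> bop (univ_dom R) (univ_cod R)"
  unfolding univ_v_def univ_dom_def univ_cod_def
  by (rule dsum_op_bop[where M = 1])
    (use R in \<open>auto intro: bi_isometry_dom bi_isometry_entry bi_isometry_entry_contractive\<close>)

lemma cinner_e2:
  assumes "\<xi> \<in> univ_dom R" "\<eta> \<in> univ_dom R"
  shows "cinner (e2 R x a \<xi>) \<eta> = cinner (univ_v R a x \<xi>) (univ_v R a x \<eta>)"
  unfolding e4_def comp_def
  by (rule cinner_adj'[OF univ_v_bop closed_univ_dom closed_univ_cod assms(2)
        bop_in[OF univ_v_bop assms(1)]])

lemma e2_in_univ_dom: "\<xi> \<in> univ_dom R \<Longrightarrow> e2 R x a \<xi> \<in> univ_dom R"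
  unfolding e4_def comp_def
  by (intro bop_in[OF adj_bop[OF univ_v_bop closed_univ_dom closed_univ_cod]] bop_in[OF univ_v_bop])

lemma e2_outside: "\<xi> \<notin> univ_dom R \<Longrightarrow> e2 R x a \<xi> = 0"
  by (simp add: e4_def bop_outside[OF univ_v_bop]
      bop_zero[OF adj_bop[OF univ_v_bop closed_univ_dom closed_univ_cod] closed_univ_cod])

text \<open>
  The index functions \<open>f\<close> and \<open>g\<close> let a row and a column of generators be treated at once.
\<close>

lemma sum_e2_eq_id:
  assumes "\<And>V \<xi> \<eta>. V \<in> R \<Longrightarrow> \<xi> \<in> dom_space V \<Longrightarrow> \<eta> \<in> dom_space V \<Longrightarrow>
      (\<Sum>i\<in>UNIV. cinner (entry V (f i) (g i) \<xi>) (entry V (f i) (g i) \<eta>)) = cinner \<xi> \<eta>"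
  shows "sum_op (\<lambda>i::'x. e2 R (g i) (f i)) = id_op (univ_dom R)"
proof
  fix \<xi>
  show "sum_op (\<lambda>i. e2 R (g i) (f i)) \<xi> = id_op (univ_dom R) \<xi>"
  proof (cases "\<xi> \<in> univ_dom R")
    case True
    show ?thesis
    proof (rule csubspace_eqI[OF closed_univ_dom])
      fix \<eta> assume \<eta>: "\<eta> \<in> univ_dom R"
      have in_dom: "hsum_nth \<xi> V \<in> dom_space V" "hsum_nth \<eta> V \<in> dom_space V" if "V \<in> R" for V
        using True \<eta> that by (auto simp: univ_dom_def dsum_space_def)
      have out: "hsum_nth \<xi> V = 0" if "V \<notin> R" for V
        using True that by (auto simp: univ_dom_def dsum_space_def)
      have "cinner (sum_op (\<lambda>i. e2 R (g i) (f i)) \<xi>) \<eta>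
          = (\<Sum>i\<in>UNIV. cinner (univ_v R (f i) (g i) \<xi>) (univ_v R (f i) (g i) \<eta>))"
        by (simp add: sum_op_def cinner_sum_left cinner_e2 True \<eta>)
      also have "\<dots> = (\<Sum>\<^sub>\<infinity>V. \<Sum>i\<in>UNIV.
          cinner (hsum_nth (univ_v R (f i) (g i) \<xi>) V) (hsum_nth (univ_v R (f i) (g i) \<eta>) V))"
        unfolding cinner_hsum_def by (simp add: infsum_sum cinner_summable)
      also have "\<dots> = cinner \<xi> \<eta>"
        unfolding cinner_hsum_def
      proof (rule infsum_cong)
        fix V
        show "(\<Sum>i\<in>UNIV. cinner (hsum_nth (univ_v R (f i) (g i) \<xi>) V)
              (hsum_nth (univ_v R (f i) (g i) \<eta>) V)) = cinner (hsum_nth \<xi> V) (hsum_nth \<eta> V)"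
          by (cases "V \<in> R") (simp_all add: hsum_nth_univ_v True \<eta> assms in_dom out)
      qed
      finally show "cinner (sum_op (\<lambda>i. e2 R (g i) (f i)) \<xi>) \<eta> = cinner (id_op (univ_dom R) \<xi>) \<eta>"
        using True by (simp add: id_op_def)
    next
      show "sum_op (\<lambda>i. e2 R (g i) (f i)) \<xi> \<in> univ_dom R"
        unfolding sum_op_def by (intro csubspace_sum[OF closed_univ_dom] e2_in_univ_dom True)
      show "id_op (univ_dom R) \<xi> \<in> univ_dom R" using True by (simp add: id_op_def)
    qed
  qed (simp add: sum_op_def id_op_def e2_outside)
qed

lemma sum_e2_row: "sum_op (\<lambda>a. e2 R x a) = id_op (univ_dom R)"
  by (rule sum_e2_eq_id) (rule bi_isometry_col[OF R])

lemma sum_e2_col: "sum_op (\<lambda>x. e2 R x a) = id_op (univ_dom R)"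
  by (rule sum_e2_eq_id) (rule bi_isometry_row[OF R])

end

section \<open>Gram matrices\<close>

text \<open>
  Induction on the index set by Schur complements: the last index is split off along a basis
  vector outside the finitely many coordinates used so far, which exists because the index type
  is infinite.  If the pivot \<open>G k k\<close> vanishes, so does its whole column, and the Schur
  complement, with division by zero giving zero, is the original matrix.
\<close>

lemma gram_vectors:
  fixes G :: "'j \<Rightarrow> 'j \<Rightarrow> complex"
  assumes inf: "infinite (UNIV :: 'k set)" and "finite J"
    and "\<And>i j. i \<in> J \<Longrightarrow> j \<in> J \<Longrightarrow> G j i = cnj (G i j)"
    and "\<And>c. (\<Sum>i\<in>J. \<Sum>j\<in>J. c i * cnj (c j) * G i j) \<in> \<real>\<^sub>\<ge>\<^sub>0"
  shows "\<exists>w :: 'j \<Rightarrow> 'k ell2. \<forall>i\<in>J. \<forall>j\<in>J. cinner (w i) (w j) = G i j"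
proof -
  have "\<exists>(w :: 'j \<Rightarrow> 'k ell2) S. finite S \<and> (\<forall>i\<in>J. \<forall>k. k \<notin> S \<longrightarrow> hsum_nth (w i) k = 0)
      \<and> (\<forall>i\<in>J. \<forall>j\<in>J. cinner (w i) (w j) = G i j)"
    using assms(2-)
  proof (induction J arbitrary: G rule: finite_induct)
    case empty
    then show ?case by auto
  next
    case (insert k J)
    note herm = insert.prems(1) and fin = insert.hyps(1) and k = insert.hyps(2)
    define Q where "Q = (\<lambda>c. \<Sum>i\<in>J. \<Sum>j\<in>J. c i * cnj (c j) * G i j)"
    define r where "r = (\<lambda>c. \<Sum>i\<in>J. c i * G i k)"
    have cnj_r: "cnj (r c) = (\<Sum>j\<in>J. cnj (c j) * G k j)" for c
      unfolding r_def cnj_sum by (rule sum.cong) (simp_all add: herm[of _ k])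
    have form: "Q c + t * cnj (r c) + cnj t * r c + t * cnj t * G k k \<in> \<real>\<^sub>\<ge>\<^sub>0" for c t
    proof -
      let ?c = "c(k := t)"
      have c: "?c i = c i" if "i \<in> J" for i using that k by auto
      have "(\<Sum>i\<in>insert k J. \<Sum>j\<in>insert k J. ?c i * cnj (?c j) * G i j)
          = t * cnj t * G k k + (\<Sum>j\<in>J. t * cnj (c j) * G k j)
            + (\<Sum>i\<in>J. c i * cnj t * G i k + (\<Sum>j\<in>J. c i * cnj (c j) * G i j))"
        by (simp add: sum.insert[OF fin k] c del: fun_upd_apply cong: sum.cong) (simp add: c)
      also have "\<dots> = Q c + t * cnj (r c) + cnj t * r c + t * cnj t * G k k"
        unfolding Q_def cnj_r unfolding r_def by (simp add: sum.distrib sum_distrib_left mult_ac)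
      finally show ?thesis using insert.prems(2)[of ?c] by simp
    qed
    have "G k k \<in> \<real>\<^sub>\<ge>\<^sub>0" using form[of "\<lambda>_. 0" 1] by (simp add: Q_def r_def)
    then obtain g where g: "G k k = of_real g" "g \<ge> 0" by (auto elim: nonneg_Reals_cases)
    have null: "G i k = 0" if g0: "g = 0" and i: "i \<in> J" for i
    proof (rule ccontr)
      assume nz: "G i k \<noteq> 0"
      define c where "c = (\<lambda>j. if j = i then 1 else 0 :: complex)"
      have single: "(\<Sum>j\<in>J. c j * f j) = f i" for f
        using i fin by (subst sum.remove[of _ i]) (auto simp: c_def intro!: sum.neutral)
      have cnj_c: "cnj (c j) = c j" for j by (simp add: c_def)
      have Qc: "Q c = G i i" and rc: "r c = G i k"
        by (simp_all add: Q_def r_def cnj_c mult.assoc sum_distrib_left[symmetric] single)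
      \<comment> \<open>At this \<open>t\<close> the form takes the value \<open>- 1\<close>.\<close>
      define s where "s = (Re (G i i) + 1) / (2 * (cmod (G i k))\<^sup>2)"
      define t where "t = - (of_real s * G i k)"
      have "Re (G i i + t * cnj (G i k) + cnj t * G i k) = - 1"
      proof -
        have "t * cnj (G i k) = - of_real (s * (cmod (G i k))\<^sup>2)"
          "cnj t * G i k = - of_real (s * (cmod (G i k))\<^sup>2)"
          by (simp_all add: t_def mult.assoc complex_norm_square mult.commute[of "cnj (G i k)"]
              del: of_real_power)
        moreover have "2 * (s * (cmod (G i k))\<^sup>2) = Re (G i i) + 1"
          using nz by (simp add: s_def)
        ultimately show ?thesis by simp
      qed
      moreover have "0 \<le> Re (G i i + t * cnj (G i k) + cnj t * G i k)"
        using form[of c t] g g0 by (simp add: Qc rc complex_nonneg_Reals_iff)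
      ultimately show False by simp
    qed
    define G' where "G' = (\<lambda>i j. G i j - G i k * G k j / of_real g)"
    have "\<exists>(w :: 'j \<Rightarrow> 'k ell2) S. finite S
        \<and> (\<forall>i\<in>J. \<forall>k. k \<notin> S \<longrightarrow> hsum_nth (w i) k = 0)
        \<and> (\<forall>i\<in>J. \<forall>j\<in>J. cinner (w i) (w j) = G' i j)"
    proof (rule insert.IH)
      show "G' j i = cnj (G' i j)" if "i \<in> J" "j \<in> J" for i j
        using that by (simp add: G'_def herm[of i j] herm[of k i] herm[of k j] mult.commute)
      show "(\<Sum>i\<in>J. \<Sum>j\<in>J. c i * cnj (c j) * G' i j) \<in> \<real>\<^sub>\<ge>\<^sub>0" for c
      proof -
        \<comment> \<open>A minimiser of the form in \<open>t\<close>; for \<open>g = 0\<close> it is \<open>0\<close>, and then the form is constant.\<close>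
        define t where "t = - (r c / of_real g)"
        have "(\<Sum>i\<in>J. \<Sum>j\<in>J. c i * cnj (c j) * G' i j)
            = Q c - (\<Sum>i\<in>J. \<Sum>j\<in>J. (c i * G i k) * (cnj (c j) * G k j) / of_real g)"
          unfolding Q_def G'_def sum_subtractf[symmetric]
          by (intro sum.cong refl) (simp add: algebra_simps)
        also have "\<dots> = Q c - r c * cnj (r c) / of_real g"
          unfolding cnj_r unfolding r_def sum_product sum_divide_distrib ..
        also have "\<dots> = Q c + t * cnj (r c) + cnj t * r c + t * cnj t * G k k"
          by (cases "g = 0") (simp_all add: t_def g field_simps)
        finally show ?thesis using form[of c t] by simp
      qed
    qed
    then obtain w :: "'j \<Rightarrow> 'k ell2" and S where S: "finite S"
      and supp: "\<And>i l. i \<in> J \<Longrightarrow> l \<notin> S \<Longrightarrow> hsum_nth (w i) l = 0"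
      and w: "\<And>i j. i \<in> J \<Longrightarrow> j \<in> J \<Longrightarrow> cinner (w i) (w j) = G' i j" by metis
    obtain l where l: "l \<notin> S" using ex_new_if_finite[OF inf S] by blast
    define u :: "'k ell2" where "u = hsum_single l 1"
    have uu: "cinner u u = 1"
      by (simp add: u_def cinner_hsum_single_right hsum_nth_single cinner_complex_def)
    have wu: "cinner (w i) u = 0" if "i \<in> J" for i
      using supp[OF that l] by (simp add: u_def cinner_hsum_single_right)
    then have uw: "cinner u (w i) = 0" if "i \<in> J" for i
      by (metis that cinner_commute complex_cnj_zero)
    define w' where "w' = (\<lambda>i. if i = k then scaleC (of_real (sqrt g)) u
        else w i + scaleC (G i k / of_real (sqrt g)) u)"
    have sq: "complex_of_real (sqrt g) * complex_of_real (sqrt g) = of_real g"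
      using g(2) by (simp flip: of_real_mult)
    have w'k: "w' k = scaleC (of_real (sqrt g)) u" by (simp add: w'_def)
    have w'J: "w' i = w i + scaleC (G i k / of_real (sqrt g)) u" if "i \<in> J" for i
      using that k by (auto simp: w'_def)
    have JJ: "cinner (w' i) (w' j) = G i j" if "i \<in> J" "j \<in> J" for i j
    proof -
      have "cinner (w' i) (w' j) = G' i j
          + (G i k * cnj (G j k)) / (complex_of_real (sqrt g) * complex_of_real (sqrt g))"
        using that by (simp add: w'J cinner_add_left cinner_add_right cinner_scaleC_left
            cinner_scaleC_right w wu uw uu)
      also have "cnj (G j k) = G k j" using herm[of j k] that by simp
      finally show ?thesis by (simp add: sq G'_def)
    qed
    have Jk: "cinner (w' i) (w' k) = G i k" if "i \<in> J" for i
      using that null[OF _ that] g(2)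
      by (cases "g = 0") (simp_all add: w'J w'k cinner_add_left cinner_scaleC_left
          cinner_scaleC_right wu uu)
    have kJ: "cinner (w' k) (w' i) = G k i" if "i \<in> J" for i
      using Jk[OF that] herm[of i k] that cinner_commute[of "w' k" "w' i"] by simp
    have kk: "cinner (w' k) (w' k) = G k k"
      by (simp add: w'k cinner_scaleC_left cinner_scaleC_right uu sq g(1))
    have "finite (insert l S)" using S by simp
    moreover have "\<forall>i\<in>insert k J. \<forall>m. m \<notin> insert l S \<longrightarrow> hsum_nth (w' i) m = 0"
      using supp by (auto simp: w'k w'J plus_hsum.rep_eq scaleC_hsum.rep_eq u_def hsum_nth_single)
    moreover have "\<forall>i\<in>insert k J. \<forall>j\<in>insert k J. cinner (w' i) (w' j) = G i j"
      using JJ Jk kJ kk by auto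
    ultimately show ?case by blast
  qed
  then show ?thesis by blast
qed

section \<open>Bi-isometries from Gram relations\<close>

text \<open>
  Subtracting from \<open>w\<close> its orthogonal projection to \<open>D\<close> leaves a vector \<open>q\<close> orthogonal to
  \<open>D\<close>, and \<open>D + \<complex>q\<close> is the preimage of \<open>D\<close> under the continuous map that removes the
  \<open>q\<close>-component.
\<close>

lemma closed_csubspace_add_line:
  fixes D :: "'a::chilbert_space set"
  assumes D: "closed_csubspace D"
  shows "closed_csubspace {d + scaleC c w | d c. d \<in> D}"
proof -
  have "\<exists>p\<in>D. \<forall>x\<in>D. cinner x w = cinner x p"
    by (rule riesz_representation[OF D, where M = "norm w"])
      (auto simp: cinner_add_left cinner_scaleC_left cmod_cinner_le mult.commute[of "norm w"])
  then obtain p where p: "p \<in> D" "\<And>x. x \<in> D \<Longrightarrow> cinner x w = cinner x p" by blast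
  define q where "q = w - p"
  have q: "cinner x q = 0" if "x \<in> D" for x using p(2)[OF that] by (simp add: q_def cinner_diff_right)
  define P where "P = (\<lambda>f. f - scaleC (cinner f q / cinner q q) q)"
  have eq: "{d + scaleC c w | d c. d \<in> D} = P -` D"
  proof (intro set_eqI iffI)
    fix f assume "f \<in> {d + scaleC c w | d c. d \<in> D}"
    then obtain d c where f: "d \<in> D" "f = d + scaleC c w" by blast
    then have f': "f = (d + scaleC c p) + scaleC c q"
      by (simp add: q_def scaleC_add_right[symmetric] add.assoc)
    have d: "d + scaleC c p \<in> D"
      using f(1) p(1) by (intro csubspace_add[OF D] csubspace_scaleC[OF D])
    have "cinner f q = c * cinner q q"
      unfolding f' cinner_add_left cinner_scaleC_left using q[OF f(1)] q[OF p(1)] by simp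
    then have "scaleC (cinner f q / cinner q q) q = scaleC c q"
      by (cases "q = 0") (simp_all add: cinner_self_eq_0)
    then have "P f = d + scaleC c p" by (simp add: P_def f')
    with d show "f \<in> P -` D" by simp
  next
    fix f assume f: "f \<in> P -` D"
    let ?c = "cinner f q / cinner q q"
    have "f = P f + scaleC ?c q" by (simp add: P_def)
    also have "\<dots> = (P f - scaleC ?c p) + scaleC ?c w"
      using scaleC_add_right[of ?c q p] by (simp add: q_def)
    finally have "f = (P f - scaleC ?c p) + scaleC ?c w" .
    moreover have "P f - scaleC ?c p \<in> D"
      using f by (intro csubspace_diff[OF D] csubspace_scaleC[OF D] p(1)) simp
    ultimately show "f \<in> {d + scaleC c w | d c. d \<in> D}" by blast
  qed
  have "bounded_linear (\<lambda>f. cinner f q / cinner q q)"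
  proof (rule bounded_linear_intro[where K = "norm q / cmod (cinner q q)"])
    show "cinner (scaleR r f) q / cinner q q = scaleR r (cinner f q / cinner q q)" for r f
      using cinner_scaleC_left[of "of_real r" f q] by (simp add: scaleC_of_real scaleR_conv_of_real)
    show "norm (cinner f q / cinner q q) \<le> norm f * (norm q / cmod (cinner q q))" for f
      using cmod_cinner_le[of f q] by (simp add: norm_divide divide_right_mono)
  qed (simp add: cinner_add_left add_divide_distrib)
  moreover have "bounded_linear (\<lambda>c. scaleC c q)"
    by (rule bounded_linear_intro[where K = "norm q"])
      (simp_all add: scaleC_add_left norm_scaleC scaleR_conv_of_real scaleC_scaleC[symmetric]
        scaleC_of_real)
  ultimately have "bounded_linear (\<lambda>f. scaleC (cinner f q / cinner q q) q)"
    using bounded_linear_compose by blast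
  then have "continuous_on UNIV P"
    unfolding P_def by (intro continuous_on_diff continuous_on_id linear_continuous_on)
  moreover have "closed D" using D by (simp add: closed_csubspace_def)
  ultimately have cl: "closed {d + scaleC c w | d c. d \<in> D}"
    unfolding eq by (intro closed_vimage)
  have "0 \<in> {d + scaleC c w | d c. d \<in> D}"
    using csubspace_zero[OF D] by (intro CollectI exI[of _ 0]) simp
  moreover have "x + y \<in> {d + scaleC c w | d c. d \<in> D}"
    if x: "x \<in> {d + scaleC c w | d c. d \<in> D}" and y: "y \<in> {d + scaleC c w | d c. d \<in> D}"
    for x y
  proof -
    obtain d c where "d \<in> D" "x = d + scaleC c w" using x by blast
    moreover obtain d' c' where "d' \<in> D" "y = d' + scaleC c' w" using y by blast
    ultimately have "x + y = (d + d') + scaleC (c + c') w" "d + d' \<in> D"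
      by (auto simp: scaleC_add_left csubspace_add[OF D])
    then show ?thesis by blast
  qed
  moreover have "scaleC b x \<in> {d + scaleC c w | d c. d \<in> D}"
    if x: "x \<in> {d + scaleC c w | d c. d \<in> D}" for b x
  proof -
    obtain d c where "d \<in> D" "x = d + scaleC c w" using x by blast
    then have "scaleC b x = scaleC b d + scaleC (b * c) w" "scaleC b d \<in> D"
      by (auto simp: scaleC_add_right scaleC_scaleC csubspace_scaleC[OF D])
    then show ?thesis by blast
  qed
  ultimately show ?thesis using cl unfolding closed_csubspace_def by blast
qed

lemma closed_csubspace_span:
  assumes "finite I"
  shows "closed_csubspace (range (\<lambda>c. \<Sum>i\<in>I. scaleC (c i) (w i :: 'a::chilbert_space)))"
  using assms
proof (induction I)
  case empty
  then show ?case by (auto simp: closed_csubspace_def)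
next
  case (insert k I)
  let ?L = "\<lambda>J c. \<Sum>i\<in>J. scaleC (c i) (w i)"
  have eq: "range (?L (insert k I)) = {d + scaleC c (w k) | d c. d \<in> range (?L I)}"
  proof (intro set_eqI iffI)
    fix f assume "f \<in> range (?L (insert k I))"
    then obtain c where "f = ?L (insert k I) c" by blast
    then have "f = ?L I c + scaleC (c k) (w k)" using insert by (simp add: add.commute)
    then show "f \<in> {d + scaleC c (w k) | d c. d \<in> range (?L I)}" by blast
  next
    fix f assume "f \<in> {d + scaleC c (w k) | d c. d \<in> range (?L I)}"
    then obtain c b where f: "f = ?L I c + scaleC b (w k)" by blast
    have "?L I (c(k := b)) = ?L I c" using insert by (intro sum.cong) auto
    then have "f = ?L (insert k I) (c(k := b))" using insert f by (simp add: add.commute)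
    then show "f \<in> range (?L (insert k I))" by blast
  qed
  show ?case unfolding eq by (rule closed_csubspace_add_line) (rule insert.IH)
qed

text \<open>
  The block \<open>V\<^sub>a\<^sub>,\<^sub>x\<close> maps \<open>\<Sum> c\<^sub>i w\<^sub>i\<close> to \<open>\<Sum> c\<^sub>i z\<^sub>x\<^sub>,\<^sub>a\<^sub>,\<^sub>i\<close>.  This is well defined and contractive
  because the square norms of the images under \<open>V\<^sub>a\<^sub>,\<^sub>x\<close>, \<open>a \<in> X\<close>, add up to that of the
  argument.
\<close>

lemma bi_isometry_from_gram:
  fixes z :: "'x::finite \<Rightarrow> 'x \<Rightarrow> 'i \<Rightarrow> 'u::chilbert_space"
  assumes fin: "finite I"
    and col: "\<And>x x' i j. i \<in> I \<Longrightarrow> j \<in> I \<Longrightarrow>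
      (\<Sum>a\<in>UNIV. cinner (z x' a i) (z x a j)) = (if x = x' then cinner (w i) (w j) else 0)"
    and row: "\<And>a a' i j. i \<in> I \<Longrightarrow> j \<in> I \<Longrightarrow>
      (\<Sum>x\<in>UNIV. cinner (z x a' i) (z x a j)) = (if a = a' then cinner (w i) (w j) else 0)"
  shows "\<exists>V. bi_isometry V \<and> (\<forall>i\<in>I. w i \<in> dom_space V) \<and>
    (\<forall>x a. \<forall>i\<in>I. entry V a x (w i) = z x a i)"
proof -
  define L where "L = (\<lambda>c. \<Sum>i\<in>I. scaleC (c i) (w i))"
  define Z where "Z = (\<lambda>x a c. \<Sum>i\<in>I. scaleC (c i) (z x a i))"
  have swap: "(\<Sum>k\<in>UNIV. cinner (Z (f k) (g k) c) (Z (f' k) (g' k) d))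
      = (\<Sum>i\<in>I. \<Sum>j\<in>I. c i * cnj (d j) * (\<Sum>k\<in>UNIV. cinner (z (f k) (g k) i) (z (f' k) (g' k) j)))"
    for f g f' g' :: "'x \<Rightarrow> 'x" and c d
    unfolding Z_def cinner_lincomb sum_distrib_left
    by (subst sum.swap, intro sum.cong refl, subst sum.swap) simp
  have colZ: "(\<Sum>a\<in>UNIV. cinner (Z x' a c) (Z x a d)) = (if x = x' then cinner (L c) (L d) else 0)"
    for x x' c d
    unfolding swap[of "\<lambda>_. x'" "\<lambda>a. a" c "\<lambda>_. x" "\<lambda>a. a"] L_def cinner_lincomb by (auto simp: col)
  have rowZ: "(\<Sum>x\<in>UNIV. cinner (Z x a' c) (Z x a d)) = (if a = a' then cinner (L c) (L d) else 0)"
    for a a' c d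
    unfolding swap[of "\<lambda>x. x" "\<lambda>_. a'" c "\<lambda>x. x" "\<lambda>_. a"] L_def cinner_lincomb by (auto simp: row)
  have contr: "norm (Z x a c) \<le> norm (L c)" for x a c
  proof -
    have "complex_of_real (\<Sum>a\<in>UNIV. (norm (Z x a c))\<^sup>2) = of_real ((norm (L c))\<^sup>2)"
      using colZ[of x c x c] by (simp add: cinner_self)
    then have "(\<Sum>a\<in>UNIV. (norm (Z x a c))\<^sup>2) = (norm (L c))\<^sup>2" by (rule of_real_eq_iff[THEN iffD1])
    moreover have "(norm (Z x a c))\<^sup>2 \<le> (\<Sum>a\<in>UNIV. (norm (Z x a c))\<^sup>2)"
      by (rule member_le_sum) auto
    ultimately have "(norm (Z x a c))\<^sup>2 \<le> (norm (L c))\<^sup>2" by simp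
    then show ?thesis by (rule power2_le_imp_le) simp
  qed
  have wd: "Z x a c = Z x a d" if "L c = L d" for x a c d
  proof -
    have "L (\<lambda>i. c i - d i) = 0"
      using that by (simp add: L_def scaleC_diff_left sum_subtractf)
    then have "Z x a (\<lambda>i. c i - d i) = 0" using contr[of x a "\<lambda>i. c i - d i"] by simp
    then show ?thesis by (simp add: Z_def scaleC_diff_left sum_subtractf)
  qed
  define v where "v = (\<lambda>a x f. if f \<in> range L then Z x a (SOME c. L c = f) else 0)"
  have v: "v a x (L c) = Z x a c" for a x c
  proof -
    have "L (SOME d. L d = L c) = L c" by (rule someI[of "\<lambda>d. L d = L c" c]) (rule refl)
    from wd[OF this, of x a] show ?thesis by (simp add: v_def)
  qed
  define V where "V = \<lparr>dom_space = range L, cod_space = UNIV, entry = v\<rparr>"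
  have D: "closed_csubspace (range L)" unfolding L_def by (rule closed_csubspace_span[OF fin])
  have Ladd: "L c + L d = L (\<lambda>i. c i + d i)" and Zadd: "Z x a c + Z x a d = Z x a (\<lambda>i. c i + d i)"
    and Lscale: "scaleC b (L c) = L (\<lambda>i. b * c i)"
    and Zscale: "scaleC b (Z x a c) = Z x a (\<lambda>i. b * c i)" for b c d x a
    by (simp_all add: L_def Z_def scaleC_add_left sum.distrib scaleC_sum_right scaleC_scaleC)
  have vB: "v a x \<in> bop (range L) UNIV" for a x
    by (rule bopI[where M = 1]) (auto simp: Ladd Lscale v Zadd Zscale contr, simp add: v_def)
  have "bi_isometry V"
    unfolding bi_isometry_iff V_def by (auto simp: D closed_csubspace_UNIV vB v colZ rowZ)
  moreover have "w i \<in> range L \<and> (\<forall>x a. v a x (w i) = z x a i)" if "i \<in> I" for i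
  proof -
    define c where "c = (\<lambda>j. if j = i then 1 else 0 :: complex)"
    have "(\<Sum>j\<in>I. scaleC (c j) (f j)) = f i" for f :: "'i \<Rightarrow> 'u"
      using that fin by (subst sum.remove[of _ i]) (auto simp: c_def intro!: sum.neutral)
    then have "L c = w i" "\<And>x a. Z x a c = z x a i" by (simp_all add: L_def Z_def)
    then show ?thesis using v by (metis rangeI)
  qed
  ultimately show ?thesis by (intro exI[of _ V]) (auto simp: V_def)
qed

section \<open>Realising positive families in the universal bi-isometry\<close>

text \<open>Polarisation: the form is real at \<open>x + y\<close> and at \<open>x + \<i>y\<close>.\<close>

lemma positive_op_hermitian:
  assumes E: "positive_op UNIV E"
  shows "cinner (E y) x = cnj (cinner (E x) y)"
proof -
  have B: "E \<in> bop UNIV UNIV" using E by (simp add: positive_op_def)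
  have real: "Im (cinner (E u) u) = 0" for u
    using E by (simp add: positive_op_def complex_nonneg_Reals_iff)
  have add: "E (u + v) = E u + E v" for u v using bop_add[OF B] by simp
  have scale: "E (scaleC c u) = scaleC c (E u)" for c u using bop_scaleC[OF B] by simp
  have "Im (cinner (E x) y + cinner (E y) x) = 0"
    using real[of "x + y"] real[of x] real[of y]
    by (simp add: add cinner_add_left cinner_add_right)
  moreover have "Re (cinner (E y) x - cinner (E x) y) = 0"
    using real[of "x + scaleC \<i> y"] real[of x] real[of y]
    by (simp add: add scale cinner_add_left cinner_add_right cinner_scaleC_left cinner_scaleC_right)
  ultimately show ?thesis by (intro complex_eqI) auto
qed

text \<open>
  The Gram matrix of the vectors sought is block diagonal in \<open>(x, a)\<close>: different blocks of the
  bi-isometry get orthogonal ranges.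
\<close>

lemma gram_vectors_positive_family:
  fixes E :: "'x::finite \<Rightarrow> 'x \<Rightarrow> 'h::chilbert_space \<Rightarrow> 'h" and \<xi> :: "nat \<Rightarrow> 'h"
  assumes inf: "infinite (UNIV :: 'k set)" and pos: "\<And>x a. positive_op UNIV (E x a)"
  shows "\<exists>z :: 'x \<Rightarrow> 'x \<Rightarrow> nat \<Rightarrow> 'k ell2. \<forall>x a x' a'. \<forall>i<n. \<forall>j<n.
    cinner (z x a i) (z x' a' j) = (if x = x' \<and> a = a' then cinner (E x a (\<xi> i)) (\<xi> j) else 0)"
proof -
  define F where "F = (\<lambda>p. E (fst p) (snd p))"
  define G where "G = (\<lambda>p q. if fst p = fst q then cinner (F (fst p) (\<xi> (snd p))) (\<xi> (snd q)) else 0)"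
  have F: "positive_op UNIV (F p)" for p using pos by (simp add: F_def)
  let ?J = "(UNIV :: ('x \<times> 'x) set) \<times> {..<n}"
  have "\<exists>w :: ('x \<times> 'x) \<times> nat \<Rightarrow> 'k ell2. \<forall>p\<in>?J. \<forall>q\<in>?J. cinner (w p) (w q) = G p q"
  proof (rule gram_vectors[OF inf])
    show "finite ?J" by simp
    show "G q p = cnj (G p q)" for p q
      using positive_op_hermitian[OF F, of "fst p" "\<xi> (snd q)" "\<xi> (snd p)"] by (auto simp: G_def)
    show "(\<Sum>p\<in>?J. \<Sum>q\<in>?J. c p * cnj (c q) * G p q) \<in> \<real>\<^sub>\<ge>\<^sub>0" for c
    proof -
      define \<eta> where "\<eta> = (\<lambda>p. \<Sum>i<n. scaleC (c (p, i)) (\<xi> i))"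
      have F_\<eta>: "F p (\<eta> p) = (\<Sum>i<n. scaleC (c (p, i)) (F p (\<xi> i)))" for p
        unfolding \<eta>_def
        by (rule bop_lincomb[where K = UNIV, OF _ closed_csubspace_UNIV])
          (use F in \<open>auto simp: positive_op_def\<close>)
      have "(\<Sum>q\<in>?J. c (p, i) * cnj (c q) * G (p, i) q)
          = (\<Sum>j<n. c (p, i) * cnj (c (p, j)) * cinner (F p (\<xi> i)) (\<xi> j))" for p i
      proof -
        have "(\<Sum>q\<in>?J. c (p, i) * cnj (c q) * G (p, i) q)
            = (\<Sum>q\<in>UNIV. \<Sum>j<n. c (p, i) * cnj (c (q, j)) * G (p, i) (q, j))"
          by (simp add: sum.cartesian_product')
        also have "\<dots> = (\<Sum>q\<in>UNIV. if p = q
            then \<Sum>j<n. c (p, i) * cnj (c (p, j)) * cinner (F p (\<xi> i)) (\<xi> j) else 0)"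
          by (intro sum.cong refl) (auto simp: G_def)
        finally show ?thesis by simp
      qed
      then have "(\<Sum>p\<in>?J. \<Sum>q\<in>?J. c p * cnj (c q) * G p q)
          = (\<Sum>p\<in>UNIV. \<Sum>i<n. \<Sum>j<n. c (p, i) * cnj (c (p, j)) * cinner (F p (\<xi> i)) (\<xi> j))"
        by (simp add: sum.cartesian_product'[of _ UNIV "{..<n}"])
      also have "\<dots> = (\<Sum>p\<in>UNIV. cinner (F p (\<eta> p)) (\<eta> p))"
        unfolding F_\<eta> unfolding \<eta>_def cinner_lincomb ..
      finally show ?thesis using F by (auto simp: positive_op_def intro!: nonneg_Reals_sum)
    qed
  qed
  then obtain w :: "('x \<times> 'x) \<times> nat \<Rightarrow> 'k ell2"
    where w: "\<And>p q. p \<in> ?J \<Longrightarrow> q \<in> ?J \<Longrightarrow> cinner (w p) (w q) = G p q" by metis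
  show ?thesis
    by (rule exI[of _ "\<lambda>x a i. w ((x, a), i)"]) (auto simp: w G_def F_def)
qed

text \<open>
  This is where the universality of \<open>v\<close> enters: the bi-isometry built from the Gram data is
  equivalent to a member of \<open>R\<close>, and a vector of its domain becomes one of the direct sum that is
  supported on that member.
\<close>

lemma realise_positive_family:
  fixes R :: "('x::finite, 'k ell2) block_op set"
    and E :: "'x \<Rightarrow> 'x \<Rightarrow> 'h::chilbert_space \<Rightarrow> 'h" and \<xi> :: "nat \<Rightarrow> 'h"
  assumes inf: "infinite (UNIV :: 'k set)" and R: "class_representatives R"
    and pos: "\<And>x a. positive_op UNIV (E x a)"
    and row: "\<And>x. sum_op (\<lambda>a. E x a) = T" and col: "\<And>a. sum_op (\<lambda>x. E x a) = T"
  shows "\<exists>\<omega>. (\<forall>i<n. \<omega> i \<in> univ_dom R) \<and>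
    (\<forall>x a. \<forall>i<n. \<forall>j<n. cinner (e2 R x a (\<omega> i)) (\<omega> j) = cinner (E x a (\<xi> i)) (\<xi> j))"
proof -
  have Rb: "\<And>V. V \<in> R \<Longrightarrow> bi_isometry V" using R by (simp add: class_representatives_def)
  obtain z :: "'x \<Rightarrow> 'x \<Rightarrow> nat \<Rightarrow> 'k ell2" where
    z: "\<And>x a x' a' i j. i < n \<Longrightarrow> j < n \<Longrightarrow> cinner (z x a i) (z x' a' j)
      = (if x = x' \<and> a = a' then cinner (E x a (\<xi> i)) (\<xi> j) else 0)"
    using gram_vectors_positive_family[where E = E and n = n and \<xi> = \<xi>, OF inf pos] by metis
  have sum_row: "(\<Sum>a\<in>UNIV. cinner (E x a u) v) = cinner (T u) v" for x u v
    unfolding row[of x, symmetric] by (simp add: sum_op_def cinner_sum_left)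
  have sum_col: "(\<Sum>x\<in>UNIV. cinner (E x a u) v) = cinner (T u) v" for a u v
    unfolding col[of a, symmetric] by (simp add: sum_op_def cinner_sum_left)
  \<comment> \<open>When the blocks have orthogonal ranges, \<open>\<xi> \<mapsto> \<Sum>\<^sub>a V\<^sub>a\<^sub>,\<^sub>x \<xi>\<close> is isometric for each \<open>x\<close>.  So
    vectors with the Gram matrix of \<open>T\<close> are the sums of the \<open>z\<close> along any one row.\<close>
  define w where "w = (\<lambda>i. \<Sum>a\<in>UNIV. z undefined a i)"
  have w: "cinner (w i) (w j) = cinner (T (\<xi> i)) (\<xi> j)" if "i < n" "j < n" for i j
    using that by (simp add: w_def cinner_sum_left cinner_sum_right z sum_row)
  have "\<exists>V. bi_isometry V \<and> (\<forall>i\<in>{..<n}. w i \<in> dom_space V) \<and>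
      (\<forall>x a. \<forall>i\<in>{..<n}. entry V a x (w i) = z x a i)"
    by (rule bi_isometry_from_gram) (auto simp: z w sum_row sum_col)
  then obtain V where V: "bi_isometry V" and wV: "\<And>i. i < n \<Longrightarrow> w i \<in> dom_space V"
    and Vw: "\<And>x a i. i < n \<Longrightarrow> entry V a x (w i) = z x a i" by auto
  obtain W where W: "W \<in> R" "unitarily_equivalent V W"
    using R V unfolding class_representatives_def by blast
  obtain U Y where U: "unitary (dom_space V) (dom_space W) U"
    and Y: "unitary (cod_space V) (cod_space W) Y"
    and UY: "\<And>a x. entry W a x \<circ> U = Y \<circ> entry V a x"
    using W(2) unfolding unitarily_equivalent_def by blast
  define \<omega> where "\<omega> = (\<lambda>i. hsum_single W (U (w i)))"
  have Uw: "U (w i) \<in> dom_space W" if "i < n" for i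
    using U wV[OF that] by (auto simp: unitary_def bop_in)
  have \<omega>: "\<omega> i \<in> univ_dom R" if "i < n" for i
    using Uw[OF that] W(1) csubspace_zero[OF bi_isometry_dom[OF Rb]]
    by (auto simp: \<omega>_def univ_dom_def dsum_space_def hsum_nth_single)
  have v\<omega>: "univ_v R a x (\<omega> i) = hsum_single W (Y (z x a i))" if i: "i < n" for a x i
  proof (rule hsum_eqI)
    fix X
    have "entry W a x (U (w i)) = Y (z x a i)"
      using UY[of a x] Vw[OF i, of a x] by (metis comp_apply)
    moreover have "entry X a x 0 = 0" if "X \<in> R"
      by (rule bop_zero[OF bi_isometry_entry[OF Rb[OF that]] bi_isometry_dom[OF Rb[OF that]]])
    ultimately show "hsum_nth (univ_v R a x (\<omega> i)) X = hsum_nth (hsum_single W (Y (z x a i))) X"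
      using W(1) by (auto simp: hsum_nth_univ_v[OF Rb \<omega>[OF i]]) (auto simp: \<omega>_def hsum_nth_single)
  qed
  have "cinner (e2 R x a (\<omega> i)) (\<omega> j) = cinner (E x a (\<xi> i)) (\<xi> j)" if ij: "i < n" "j < n" for x a i j
  proof -
    have zc: "z x a i \<in> cod_space V" if "i < n" for i
      using bop_in[OF bi_isometry_entry[OF V] wV[OF that], of a x] Vw[OF that, of a x] by simp
    have "cinner (e2 R x a (\<omega> i)) (\<omega> j) = cinner (Y (z x a i)) (Y (z x a j))"
      by (simp add: cinner_e2[OF Rb \<omega>[OF ij(1)] \<omega>[OF ij(2)]] v\<omega> ij cinner_hsum_single_right
          hsum_nth_single)
    also have "\<dots> = cinner (z x a i) (z x a j)"
      using Y zc[OF ij(1)] zc[OF ij(2)] by (simp add: unitary_def)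
    finally show ?thesis by (simp add: z ij)
  qed
  with \<omega> show ?thesis by blast
qed

section \<open>Linear maps on the span of the generators\<close>

definition op_lincomb :: "'i set \<Rightarrow> ('i \<Rightarrow> complex) \<Rightarrow> ('i \<Rightarrow> 'a \<Rightarrow> 'b::chilbert_space) \<Rightarrow> 'a \<Rightarrow> 'b" where
  "op_lincomb P c T = (\<lambda>\<xi>. \<Sum>p\<in>P. scaleC (c p) (T p \<xi>))"

lemma cinner_op_lincomb: "cinner (op_lincomb P c T \<xi>) \<eta> = (\<Sum>p\<in>P. c p * cinner (T p \<xi>) \<eta>)"
  by (simp add: op_lincomb_def cinner_sum_left cinner_scaleC_left)

lemma op_lincomb_insert:
  "finite P \<Longrightarrow> p \<notin> P \<Longrightarrow>
    op_lincomb (insert p P) c T = add_op (scale_op (c p) (T p)) (op_lincomb P c T)"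
  by (simp add: op_lincomb_def add_op_def scale_op_def)

lemma op_lincomb_empty: "op_lincomb {} c T = scale_op 0 S"
  by (simp add: op_lincomb_def scale_op_def)

lemma add_op_lincomb: "add_op (op_lincomb P c T) (op_lincomb P d T) = op_lincomb P (\<lambda>p. c p + d p) T"
  by (simp add: op_lincomb_def add_op_def scaleC_add_left sum.distrib)

lemma scale_op_lincomb: "scale_op b (op_lincomb P c T) = op_lincomb P (\<lambda>p. b * c p) T"
  by (simp add: op_lincomb_def scale_op_def scaleC_sum_right scaleC_scaleC)

lemma op_lincomb_single:
  assumes "finite P" "p \<in> P"
  shows "op_lincomb P (\<lambda>q. if q = p then 1 else 0) T = T p"
proof
  show "op_lincomb P (\<lambda>q. if q = p then 1 else 0) T \<xi> = T p \<xi>" for \<xi>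
    unfolding op_lincomb_def using assms
    by (subst sum.remove[of _ p]) (auto intro!: sum.neutral)
qed

lemma op_lincomb_in:
  assumes "finite P" "S \<in> C" "\<And>p. p \<in> P \<Longrightarrow> T p \<in> C"
    and "\<And>S T. S \<in> C \<Longrightarrow> T \<in> C \<Longrightarrow> add_op S T \<in> C" "\<And>c T. T \<in> C \<Longrightarrow> scale_op c T \<in> C"
  shows "op_lincomb P c T \<in> C"
  using assms(1,3)
  by (induction P rule: finite_induct) (auto simp: op_lincomb_insert op_lincomb_empty[of _ _ S] assms)

abbreviation e_pair :: "('x, 'u::chilbert_space) block_op set \<Rightarrow> 'x \<times> 'x \<Rightarrow>
    ('x, 'u) univ_space \<Rightarrow> ('x, 'u) univ_space" where
  "e_pair R p \<equiv> e2 R (fst p) (snd p)"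

lemma S_X_eq: "S_X R = range (\<lambda>c. op_lincomb UNIV c (e_pair R))"
  unfolding S_X_def span_op_def op_lincomb_def sum_op_def scale_op_def case_prod_unfold by blast

lemma op_lincomb_in_S_X: "op_lincomb UNIV c (e_pair R) \<in> S_X R"
  by (simp add: S_X_eq)

lemma S_X_add: "s \<in> S_X R \<Longrightarrow> t \<in> S_X R \<Longrightarrow> add_op s t \<in> S_X R"
  by (auto simp: S_X_eq add_op_lincomb)

lemma S_X_scale: "s \<in> S_X R \<Longrightarrow> scale_op c s \<in> S_X R"
  by (auto simp: S_X_eq scale_op_lincomb)

lemma e_in_S_X: "e2 R x a \<in> S_X R"
  using op_lincomb_in_S_X[of "\<lambda>q. if q = (x, a) then 1 else 0" R]
  by (simp add: op_lincomb_single[of UNIV "(x, a)"])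

text \<open>Positivity of a matrix refers to \<open>M\<^sub>n(C_X R)\<close>, so its entries have to be known to lie there.\<close>

lemma S_X_subset_C_X: "S_X R \<subseteq> C_X R"
proof
  fix s assume "s \<in> S_X R"
  then obtain c where s: "s = op_lincomb UNIV c (e_pair R)" by (auto simp: S_X_eq)
  show "s \<in> C_X R"
    unfolding C_X_def cstar_generated_def
  proof (rule InterI, clarify)
    fix C assume C: "cstar_subalgebra (univ_dom R) C"
      and gen: "{e4 R x x' a a' | x x' a a'. True} \<subseteq> C"
    show "s \<in> C"
      unfolding s
    proof (rule op_lincomb_in[where S = "id_op (univ_dom R)"])
      show "e_pair R p \<in> C" for p using gen by blast
    qed (use C in \<open>auto simp: cstar_subalgebra_def\<close>)
  qed
qed

lemma linear_on_S_X_lincomb: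
  assumes \<phi>: "linear_on_S_X R \<phi>" and "finite P"
  shows "\<phi> (op_lincomb P c (e_pair R)) = op_lincomb P c (\<lambda>p. \<phi> (e_pair R p))"
  using assms(2)
proof (induction P rule: finite_induct)
  case empty
  let ?s = "e2 R undefined undefined"
  have "\<phi> (scale_op 0 ?s) = scale_op 0 (\<phi> ?s)"
    using \<phi> e_in_S_X unfolding linear_on_S_X_def by blast
  then show ?case by (simp only: op_lincomb_empty[of _ _ ?s] op_lincomb_empty[of _ _ "\<phi> ?s"])
next
  case (insert p P)
  have s: "op_lincomb P c (e_pair R) \<in> S_X R"
    by (rule op_lincomb_in[where S = "e_pair R p"])
      (use insert.hyps in \<open>auto intro: e_in_S_X S_X_add S_X_scale\<close>)
  have "\<phi> (add_op (scale_op (c p) (e_pair R p)) (op_lincomb P c (e_pair R)))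
      = add_op (\<phi> (scale_op (c p) (e_pair R p))) (\<phi> (op_lincomb P c (e_pair R)))"
    using \<phi> s S_X_scale[OF e_in_S_X] unfolding linear_on_S_X_def by blast
  also have "\<phi> (scale_op (c p) (e_pair R p)) = scale_op (c p) (\<phi> (e_pair R p))"
    using \<phi> e_in_S_X unfolding linear_on_S_X_def by blast
  finally show ?case using insert by (simp add: op_lincomb_insert)
qed

lemma op_lincomb_image:
  "inj f \<Longrightarrow> op_lincomb (range f) (\<lambda>_. 1) T = sum_op (\<lambda>i. T (f i))"
  by (simp add: op_lincomb_def sum_op_def sum.reindex)

lemma linear_on_S_X_sum:
  fixes f :: "'x::finite \<Rightarrow> 'x \<times> 'x"
  assumes "linear_on_S_X R \<phi>" "inj f"
  shows "\<phi> (sum_op (\<lambda>i. e_pair R (f i))) = sum_op (\<lambda>i. \<phi> (e_pair R (f i)))"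
  using linear_on_S_X_lincomb[OF assms(1), of "range f" "\<lambda>_. 1"] assms(2)
  by (simp add: op_lincomb_image)

context
  fixes R :: "('x::finite, 'k ell2) block_op set"
  assumes inf: "infinite (UNIV :: 'k set)" and R: "class_representatives R"
begin

lemma bi_isometry_R: "V \<in> R \<Longrightarrow> bi_isometry V"
  using R by (simp add: class_representatives_def)

text \<open>
  The relations between the generators force equal row and column sums on the values of any linear
  map; positivity of the values is then the only condition left for complete positivity.
\<close>

lemma linear_on_S_X_marginals:
  assumes \<phi>: "linear_on_S_X R \<phi>"
  shows linear_on_S_X_row: "sum_op (\<lambda>a. \<phi> (e2 R x a)) = \<phi> (id_op (univ_dom R))"
    and linear_on_S_X_col: "sum_op (\<lambda>x. \<phi> (e2 R x a)) = \<phi> (id_op (univ_dom R))"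
  using linear_on_S_X_sum[OF \<phi>, of "\<lambda>a. (x, a)"] linear_on_S_X_sum[OF \<phi>, of "\<lambda>x. (x, a)"]
  by (simp_all add: inj_on_def sum_e2_row[OF bi_isometry_R] sum_e2_col[OF bi_isometry_R])

lemma cp_imp_positive:
  assumes \<phi>: "linear_on_S_X R \<phi>" "cp_on_S_X R \<phi>"
  shows "positive_op UNIV (\<phi> (e2 R x a))"
proof -
  have "mat_pos (univ_dom R) (C_X R) 1 (\<lambda>_ _. e2 R x a)"
    using subsetD[OF S_X_subset_C_X e_in_S_X]
    by (auto simp: mat_pos_def cinner_e2[OF bi_isometry_R] cinner_self_nonneg)
  then have "mat_pos UNIV (bop UNIV UNIV) 1 (\<lambda>_ _. \<phi> (e2 R x a))"
    using \<phi>(2) e_in_S_X[of R x a] unfolding cp_on_S_X_def by fastforce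
  then show ?thesis by (auto simp: mat_pos_def positive_op_def)
qed

text \<open>
  The quadratic form of \<open>(\<phi>(A\<^sub>i\<^sub>j))\<close> at \<open>(\<xi>\<^sub>i)\<close> depends only on the numbers \<open>\<langle>\<phi>(e\<^sub>x\<^sub>,\<^sub>a) \<xi>\<^sub>j, \<xi>\<^sub>i\<rangle>\<close>, which
  are also the numbers \<open>\<langle>e\<^sub>x\<^sub>,\<^sub>a \<omega>\<^sub>j, \<omega>\<^sub>i\<rangle>\<close> for suitable \<open>\<omega>\<^sub>i\<close>.
\<close>

lemma positive_imp_cp:
  fixes \<phi> :: "(('x, 'k ell2) univ_space \<Rightarrow> ('x, 'k ell2) univ_space) \<Rightarrow> 'h::chilbert_space \<Rightarrow> 'h"
  assumes \<phi>: "linear_on_S_X R \<phi>" and pos: "\<And>x a. positive_op UNIV (\<phi> (e2 R x a))"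
  shows "cp_on_S_X R \<phi>"
  unfolding cp_on_S_X_def
proof (intro allI impI, elim conjE)
  fix n A
  assume A: "\<forall>i<n. \<forall>j<n. A i j \<in> S_X R" and A_pos: "mat_pos (univ_dom R) (C_X R) n A"
  define c where "c = (\<lambda>i j. SOME c. A i j = op_lincomb UNIV c (e_pair R))"
  have c: "A i j = op_lincomb UNIV (c i j) (e_pair R)" if "i < n" "j < n" for i j
  proof -
    have "A i j \<in> S_X R" using A that by blast
    then have "\<exists>c. A i j = op_lincomb UNIV c (e_pair R)" unfolding S_X_eq by blast
    then show ?thesis unfolding c_def by (rule someI_ex)
  qed
  have \<phi>A: "\<phi> (A i j) = op_lincomb UNIV (c i j) (\<lambda>p. \<phi> (e_pair R p))" if "i < n" "j < n" for i j
    using that by (simp add: c linear_on_S_X_lincomb[OF \<phi>])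
  show "mat_pos UNIV (bop UNIV UNIV) n (\<lambda>i j. \<phi> (A i j))"
    unfolding mat_pos_def
  proof (intro conjI allI impI)
    show "\<phi> (A i j) \<in> bop UNIV UNIV" if "i < n" "j < n" for i j
      using that A \<phi> by (simp add: linear_on_S_X_def)
    fix \<xi> :: "nat \<Rightarrow> 'h"
    obtain \<omega> where \<omega>: "\<And>i. i < n \<Longrightarrow> \<omega> i \<in> univ_dom R"
      and e\<omega>: "\<And>x a i j. i < n \<Longrightarrow> j < n \<Longrightarrow>
        cinner (e2 R x a (\<omega> i)) (\<omega> j) = cinner (\<phi> (e2 R x a) (\<xi> i)) (\<xi> j)"
      using realise_positive_family[where E = "\<lambda>x a. \<phi> (e2 R x a)" and n = n and \<xi> = \<xi>,
          OF inf R pos linear_on_S_X_row[OF \<phi>] linear_on_S_X_col[OF \<phi>]] by metis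
    have "(\<Sum>i<n. \<Sum>j<n. cinner (\<phi> (A i j) (\<xi> j)) (\<xi> i))
        = (\<Sum>i<n. \<Sum>j<n. cinner (A i j (\<omega> j)) (\<omega> i))"
      by (intro sum.cong refl) (simp add: \<phi>A cinner_op_lincomb, simp add: c cinner_op_lincomb e\<omega>)
    also have "\<dots> \<in> \<real>\<^sub>\<ge>\<^sub>0" using A_pos \<omega> by (simp add: mat_pos_def)
    finally show "(\<Sum>i<n. \<Sum>j<n. cinner (\<phi> (A i j) (\<xi> j)) (\<xi> i)) \<in> \<real>\<^sub>\<ge>\<^sub>0" .
  qed
qed

lemma ucp_iff_quantum_magic_square:
  assumes \<phi>: "linear_on_S_X R \<phi>"
  shows "unital_on_S_X R \<phi> \<and> cp_on_S_X R \<phi> \<longleftrightarrow> quantum_magic_square (\<lambda>x a. \<phi> (e2 R x a))"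
proof -
  have "cp_on_S_X R \<phi> \<longleftrightarrow> (\<forall>x a. positive_op UNIV (\<phi> (e2 R x a)))"
    using cp_imp_positive[OF \<phi>] positive_imp_cp[OF \<phi>] by blast
  then show ?thesis
    unfolding unital_on_S_X_def quantum_magic_square_def
      linear_on_S_X_row[OF \<phi>] linear_on_S_X_col[OF \<phi>] by blast
qed

text \<open>
  The generators are linearly dependent in general.  Their relations carry over to any quantum
  magic square because each matrix coefficient \<open>\<langle>E\<^sub>x\<^sub>,\<^sub>a \<xi>, \<eta>\<rangle>\<close> equals \<open>\<langle>e\<^sub>x\<^sub>,\<^sub>a \<omega>\<^sub>0, \<omega>\<^sub>1\<rangle>\<close> with vectors
  \<open>\<omega>\<^sub>0, \<omega>\<^sub>1\<close> that are the same for all \<open>(x, a)\<close>.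
\<close>

lemma lincomb_e_eq_imp_lincomb_eq:
  fixes E :: "'x \<Rightarrow> 'x \<Rightarrow> 'h::chilbert_space \<Rightarrow> 'h"
  assumes E: "quantum_magic_square E"
    and eq: "op_lincomb UNIV c (e_pair R) = op_lincomb UNIV d (e_pair R)"
  shows "op_lincomb UNIV c (\<lambda>p. E (fst p) (snd p)) = op_lincomb UNIV d (\<lambda>p. E (fst p) (snd p))"
proof (rule ext, rule csubspace_eqI[OF closed_csubspace_UNIV])
  fix \<xi> \<eta> :: 'h
  let ?\<xi> = "\<lambda>i :: nat. if i = 0 then \<xi> else \<eta>"
  have QMS: "\<And>x a. positive_op UNIV (E x a)" "\<And>x. sum_op (\<lambda>a. E x a) = id_op UNIV"
    "\<And>a. sum_op (\<lambda>x. E x a) = id_op UNIV"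
    using E by (auto simp: quantum_magic_square_def)
  obtain \<omega> where "\<And>x a i j. i < 2 \<Longrightarrow> j < 2 \<Longrightarrow>
        cinner (e2 R x a (\<omega> i)) (\<omega> j) = cinner (E x a (?\<xi> i)) (?\<xi> j)"
    using realise_positive_family[where E = E and n = 2 and \<xi> = ?\<xi>, OF inf R QMS] by metis
  from this[of 0 1] have "cinner (e2 R x a (\<omega> 0)) (\<omega> 1) = cinner (E x a \<xi>) \<eta>" for x a by simp
  then have "cinner (op_lincomb UNIV b (\<lambda>p. E (fst p) (snd p)) \<xi>) \<eta>
      = cinner (op_lincomb UNIV b (e_pair R) (\<omega> 0)) (\<omega> 1)" for b
    by (simp add: cinner_op_lincomb)
  then show "cinner (op_lincomb UNIV c (\<lambda>p. E (fst p) (snd p)) \<xi>) \<eta>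
      = cinner (op_lincomb UNIV d (\<lambda>p. E (fst p) (snd p)) \<xi>) \<eta>"
    by (simp add: eq)
qed simp_all

text \<open>The value at \<open>s\<close> is read off from an arbitrary expansion of \<open>s\<close> in the generators.\<close>

lemma ucp_extension:
  fixes E :: "'x \<Rightarrow> 'x \<Rightarrow> 'h::chilbert_space \<Rightarrow> 'h"
  assumes E: "quantum_magic_square E"
  shows "\<exists>\<phi>. linear_on_S_X R \<phi> \<and> unital_on_S_X R \<phi> \<and> cp_on_S_X R \<phi> \<and> (\<forall>x a. \<phi> (e2 R x a) = E x a)"
proof -
  let ?e = "\<lambda>c. op_lincomb UNIV c (e_pair R)"
  let ?E = "\<lambda>c. op_lincomb UNIV c (\<lambda>p. E (fst p) (snd p))"
  define \<phi> where "\<phi> = (\<lambda>s. ?E (SOME c. ?e c = s))"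
  have \<phi>: "\<phi> (?e c) = ?E c" for c
    unfolding \<phi>_def by (rule lincomb_e_eq_imp_lincomb_eq[OF E])
      (rule someI[of "\<lambda>d. ?e d = ?e c" c], simp)
  have EB: "E x a \<in> bop UNIV UNIV" for x a
    using E by (simp add: quantum_magic_square_def positive_op_def)
  have "?E c \<in> bop UNIV UNIV" for c
  proof (rule op_lincomb_in[OF finite])
    show "E undefined undefined \<in> bop UNIV UNIV" "E (fst p) (snd p) \<in> bop UNIV UNIV" for p
      by (rule EB)+
    show "add_op S T \<in> bop UNIV UNIV" if S: "S \<in> bop UNIV UNIV" and T: "T \<in> bop UNIV UNIV" for S T :: "'h \<Rightarrow> 'h"
    proof -
      obtain M N where "\<forall>x. norm (S x) \<le> M * norm x" "\<forall>x. norm (T x) \<le> N * norm x"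
        using bop_bounded[OF S] bop_bounded[OF T] by auto
      then have "norm (S x + T x) \<le> (M + N) * norm x" for x
        using norm_triangle_le[of "S x" "T x"] by (simp add: add_mono distrib_right)
      then show ?thesis
        using bop_add[OF S] bop_add[OF T] bop_scaleC[OF S] bop_scaleC[OF T]
        by (intro bopI[where M = "M + N"]) (auto simp: add_op_def scaleC_add_right)
    qed
    show "scale_op b T \<in> bop UNIV UNIV" if T: "T \<in> bop UNIV UNIV" for b and T :: "'h \<Rightarrow> 'h"
    proof -
      obtain M where "\<forall>x. norm (T x) \<le> M * norm x" using bop_bounded[OF T] by auto
      then have "norm (scaleC b (T x)) \<le> (cmod b * M) * norm x" for x
        by (simp add: norm_scaleC mult.assoc mult_left_mono)
      then show ?thesis
        using bop_add[OF T] bop_scaleC[OF T]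
        by (intro bopI[where M = "cmod b * M"])
          (auto simp: scale_op_def scaleC_add_right scaleC_scaleC mult.commute)
    qed
  qed
  then have lin: "linear_on_S_X R \<phi>"
    unfolding linear_on_S_X_def S_X_eq by (auto simp: \<phi> add_op_lincomb scale_op_lincomb)
  have val: "\<phi> (e2 R x a) = E x a" for x a
    using \<phi>[of "\<lambda>q. if q = (x, a) then 1 else 0"]
    by (simp add: op_lincomb_single[of UNIV "(x, a)"])
  have "unital_on_S_X R \<phi> \<and> cp_on_S_X R \<phi>"
    using ucp_iff_quantum_magic_square[OF lin] E by (simp add: val)
  with lin val show ?thesis by blast
qed

end

section \<open>Quantum magic squares and completely positive maps\<close>

theorem theorem4p1:
  fixes R :: "('x::finite, 'k ell2) block_op set"
  assumes "infinite (UNIV :: 'k set)"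
    and "class_representatives R"
  shows "(\<forall>\<phi> :: (('x, 'k ell2) univ_space \<Rightarrow> ('x, 'k ell2) univ_space) \<Rightarrow> ('h::chilbert_space \<Rightarrow> 'h).
            linear_on_S_X R \<phi> \<longrightarrow>
              ((unital_on_S_X R \<phi> \<and> cp_on_S_X R \<phi>) \<longleftrightarrow>
                 quantum_magic_square (\<lambda>x a. \<phi> (e2 R x a))) \<and>
              (cp_on_S_X R \<phi> \<longleftrightarrow> positive_family (\<lambda>x a. \<phi> (e2 R x a)))) \<and>
         (\<forall>E :: 'x \<Rightarrow> 'x \<Rightarrow> 'h \<Rightarrow> 'h. quantum_magic_square E \<longrightarrow>
            (\<exists>\<phi>. linear_on_S_X R \<phi> \<and> unital_on_S_X R \<phi> \<and> cp_on_S_X R \<phi> \<and>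
                 (\<forall>x a. \<phi> (e2 R x a) = E x a) \<and>
                 (\<forall>\<psi>. linear_on_S_X R \<psi> \<and> unital_on_S_X R \<psi> \<and> cp_on_S_X R \<psi> \<and>
                      (\<forall>x a. \<psi> (e2 R x a) = E x a)
                      \<longrightarrow> (\<forall>s\<in>S_X R. \<psi> s = \<phi> s))))"
proof (intro conjI allI impI)
  fix \<phi> :: "(('x, 'k ell2) univ_space \<Rightarrow> ('x, 'k ell2) univ_space) \<Rightarrow> 'h \<Rightarrow> 'h"
  assume \<phi>: "linear_on_S_X R \<phi>"
  show "(unital_on_S_X R \<phi> \<and> cp_on_S_X R \<phi>) \<longleftrightarrow> quantum_magic_square (\<lambda>x a. \<phi> (e2 R x a))"
    by (rule ucp_iff_quantum_magic_square[OF assms \<phi>])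
  have "\<phi> (e2 R x a) \<in> bop UNIV UNIV" for x a
    using \<phi> e_in_S_X unfolding linear_on_S_X_def by blast
  then have "positive_family (\<lambda>x a. \<phi> (e2 R x a)) \<longleftrightarrow> (\<forall>x a. positive_op UNIV (\<phi> (e2 R x a)))"
    by (rule positive_family_iff)
  then show "cp_on_S_X R \<phi> \<longleftrightarrow> positive_family (\<lambda>x a. \<phi> (e2 R x a))"
    using cp_imp_positive[OF assms \<phi>] positive_imp_cp[OF assms \<phi>] by blast
next
  fix E :: "'x \<Rightarrow> 'x \<Rightarrow> 'h \<Rightarrow> 'h"
  assume "quantum_magic_square E"
  then obtain \<phi> where \<phi>: "linear_on_S_X R \<phi>" "unital_on_S_X R \<phi>" "cp_on_S_X R \<phi>"
      "\<And>x a. \<phi> (e2 R x a) = E x a"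
    using ucp_extension[OF assms] by blast
  have "\<psi> s = \<phi> s"
    if \<psi>: "linear_on_S_X R \<psi>" "\<And>x a. \<psi> (e2 R x a) = E x a" and s: "s \<in> S_X R" for \<psi> s
  proof -
    obtain c where "s = op_lincomb UNIV c (e_pair R)" using s by (auto simp: S_X_eq)
    then show ?thesis
      by (simp add: linear_on_S_X_lincomb[OF \<psi>(1)] linear_on_S_X_lincomb[OF \<phi>(1)] \<psi>(2) \<phi>(4))
  qed
  with \<phi> show "\<exists>\<phi>. linear_on_S_X R \<phi> \<and> unital_on_S_X R \<phi> \<and> cp_on_S_X R \<phi> \<and>
      (\<forall>x a. \<phi> (e2 R x a) = E x a) \<and>
      (\<forall>\<psi>. linear_on_S_X R \<psi> \<and> unital_on_S_X R \<psi> \<and> cp_on_S_X R \<psi> \<and>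
        (\<forall>x a. \<psi> (e2 R x a) = E x a) \<longrightarrow> (\<forall>s\<in>S_X R. \<psi> s = \<phi> s))"
    by blast
qed

end
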